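(* Let $M$ be a smooth Riemannian manifold, $V$ a smooth vector bundle on $M$, and $\nabla$ a connection on $V$, extended to a covariant derivative on the space $\Omega^*(V)$ of smooth $V$-valued differential forms. For any two smooth vector fields $X$ and $Y$ on $M$ and any $\omega\in\Omega^*(V)$, $$[X,Y]\lrcorner\omega=X\lrcorner\nabla(Y\lrcorner\omega)+\nabla\big(X\lrcorner(Y\lrcorner\omega)\big)-Y\lrcorner(X\lrcorner\nabla\omega)-Y\lrcorner\nabla(X\lrcorner\omega).$$
   Context: $[X,Y]$ is the usual Lie bracket of vector fields. $\lrcorner$ denotes contraction of a form by a vector field, acting on the form part of a $V$-valued form: $X\lrcorner(\tau\otimes s)=(X\lrcorner\tau)\otimes s$. The extension of $\nabla$ to $V$-valued forms is $\nabla(\tau\otimes s)=d\tau\otimes s+(-1)^k\tau\wedge\nabla s$ for a $k$-form $\tau$ and a smooth section $s$ of $V$. *)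

theory Defs
  imports "HOL-Analysis.Analysis"
begin

section \<open>Smooth maps between open subsets of normed spaces\<close>

text \<open>For a finite-dimensional domain and open \<open>S\<close> this is the usual notion: all iterated
  directional derivatives exist and are (Frechet) differentiable and continuous.\<close>

fun Ck_on :: "nat \<Rightarrow> 'a::real_normed_vector set \<Rightarrow> ('a \<Rightarrow> 'b::real_normed_vector) \<Rightarrow> bool" where
  "Ck_on 0 S f \<longleftrightarrow> continuous_on S f"
| "Ck_on (Suc n) S f \<longleftrightarrow> (\<forall>x\<in>S. f differentiable (at x)) \<and>
     (\<forall>v. Ck_on n S (\<lambda>x. frechet_derivative f (at x) v))"

definition smooth_on :: "'a::real_normed_vector set \<Rightarrow> ('a \<Rightarrow> 'b::real_normed_vector) \<Rightarrow> bool" where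
  "smooth_on S f \<longleftrightarrow> (\<forall>n. Ck_on n S f)"


section \<open>Smooth manifolds\<close>

text \<open>The points of \<open>M\<close> are the elements of a Hausdorff, second countable type \<open>'m\<close>.
  The model space \<open>'e\<close> is any inner product space of finite dimension; the class
  \<open>euclidean_space\<close> would exclude dimension 0. A chart is a pair \<open>(U, \<phi>)\<close>, where only the
  restriction of \<open>\<phi>\<close> to \<open>U\<close> is relevant. The atlas need not be maximal.\<close>

type_synonym ('m, 'e) chart = "'m set \<times> ('m \<Rightarrow> 'e)"

definition chart_inv :: "('m, 'e) chart \<Rightarrow> 'e \<Rightarrow> 'm" where
  "chart_inv \<kappa> = inv_into (fst \<kappa>) (snd \<kappa>)"

definition smooth_atlas ::
    "('m::{t2_space,second_countable_topology}, 'e::real_inner) chart set \<Rightarrow> bool" where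
  "smooth_atlas A \<longleftrightarrow>
     (\<exists>B::'e set. finite B \<and> span B = UNIV) \<and>
     (\<Union>\<kappa>\<in>A. fst \<kappa>) = UNIV \<and>
     (\<forall>\<kappa>\<in>A. open (fst \<kappa>) \<and> open (snd \<kappa> ` fst \<kappa>) \<and>
        homeomorphism (fst \<kappa>) (snd \<kappa> ` fst \<kappa>) (snd \<kappa>) (chart_inv \<kappa>)) \<and>
     (\<forall>\<kappa>\<in>A. \<forall>\<mu>\<in>A. smooth_on (snd \<kappa> ` (fst \<kappa> \<inter> fst \<mu>)) (snd \<mu> \<circ> chart_inv \<kappa>))"

definition smooth_map_on ::
    "('m, 'e::real_normed_vector) chart set \<Rightarrow> 'm set \<Rightarrow> ('m \<Rightarrow> 'b::real_normed_vector) \<Rightarrow> bool" where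
  "smooth_map_on A U f \<longleftrightarrow> (\<forall>\<kappa>\<in>A. smooth_on (snd \<kappa> ` (fst \<kappa> \<inter> U)) (f \<circ> chart_inv \<kappa>))"


section \<open>Tangent vectors and vector fields\<close>

text \<open>A tangent vector at \<open>p\<close> is the family of its coordinate vectors in all charts around \<open>p\<close>;
  these are related by the derivatives of the transition maps. Entries at other charts are 0.
  The vector space operations on a tangent space are pointwise.\<close>

type_synonym ('m, 'e) tangent = "('m, 'e) chart \<Rightarrow> 'e"

definition tangent_space ::
    "('m, 'e::real_normed_vector) chart set \<Rightarrow> 'm \<Rightarrow> ('m, 'e) tangent set" where
  "tangent_space A p =
     {v. (\<forall>\<kappa>. \<not> (\<kappa> \<in> A \<and> p \<in> fst \<kappa>) \<longrightarrow> v \<kappa> = 0) \<and>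
         (\<forall>\<kappa>\<in>A. \<forall>\<mu>\<in>A. p \<in> fst \<kappa> \<inter> fst \<mu> \<longrightarrow>
            v \<mu> = frechet_derivative (snd \<mu> \<circ> chart_inv \<kappa>) (at (snd \<kappa> p)) (v \<kappa>))}"

text \<open>The tangent vector at \<open>p\<close> whose coordinate vector in the chart \<open>\<kappa>\<close> is \<open>e\<close>.\<close>

definition coord_vec ::
    "('m, 'e::real_normed_vector) chart set \<Rightarrow> ('m, 'e) chart \<Rightarrow> 'm \<Rightarrow> 'e \<Rightarrow> ('m, 'e) tangent" where
  "coord_vec A \<kappa> p e = (\<lambda>\<mu>. if \<mu> \<in> A \<and> p \<in> fst \<mu>
     then frechet_derivative (snd \<mu> \<circ> chart_inv \<kappa>) (at (snd \<kappa> p)) e else 0)"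

definition smooth_vector_field ::
    "('m, 'e::real_normed_vector) chart set \<Rightarrow> ('m \<Rightarrow> ('m, 'e) tangent) \<Rightarrow> bool" where
  "smooth_vector_field A X \<longleftrightarrow>
     (\<forall>p. X p \<in> tangent_space A p) \<and>
     (\<forall>\<kappa>\<in>A. smooth_on (snd \<kappa> ` fst \<kappa>) (\<lambda>x. X (chart_inv \<kappa> x) \<kappa>))"

text \<open>In a chart, \<open>[X,Y]\<^sup>i = X\<^sup>j \<partial>\<^sub>j Y\<^sup>i - Y\<^sup>j \<partial>\<^sub>j X\<^sup>i\<close>.\<close>

definition lie_bracket ::
    "('m, 'e::real_normed_vector) chart set \<Rightarrow> ('m \<Rightarrow> ('m, 'e) tangent) \<Rightarrow>
     ('m \<Rightarrow> ('m, 'e) tangent) \<Rightarrow> 'm \<Rightarrow> ('m, 'e) tangent" where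
  "lie_bracket A X Y p = (\<lambda>\<kappa>. if \<kappa> \<in> A \<and> p \<in> fst \<kappa>
     then frechet_derivative (\<lambda>x. Y (chart_inv \<kappa> x) \<kappa>) (at (snd \<kappa> p)) (X p \<kappa>)
        - frechet_derivative (\<lambda>x. X (chart_inv \<kappa> x) \<kappa>) (at (snd \<kappa> p)) (Y p \<kappa>)
     else 0)"

definition riemannian_metric ::
    "('m, 'e::real_normed_vector) chart set \<Rightarrow>
     ('m \<Rightarrow> ('m, 'e) tangent \<Rightarrow> ('m, 'e) tangent \<Rightarrow> real) \<Rightarrow> bool" where
  "riemannian_metric A g \<longleftrightarrow>
     (\<forall>p. \<forall>u\<in>tangent_space A p. \<forall>v\<in>tangent_space A p.
        g p u v = g p v u \<and>
        (\<forall>w\<in>tangent_space A p. \<forall>a b.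
           g p (\<lambda>\<kappa>. a *\<^sub>R u \<kappa> + b *\<^sub>R v \<kappa>) w = a * g p u w + b * g p v w)) \<and>
     (\<forall>p. \<forall>v\<in>tangent_space A p. v \<noteq> (\<lambda>\<kappa>. 0) \<longrightarrow> g p v v > 0) \<and>
     (\<forall>\<kappa>\<in>A. \<forall>d e. smooth_on (snd \<kappa> ` fst \<kappa>)
        (\<lambda>x. g (chart_inv \<kappa> x) (coord_vec A \<kappa> (chart_inv \<kappa> x) d) (coord_vec A \<kappa> (chart_inv \<kappa> x) e)))"


section \<open>Vector bundles\<close>

text \<open>The fibre \<open>V p\<close> is a subspace of an auxiliary real vector space \<open>'w\<close>, which only provides
  the linear operations of the fibres (it can be taken to be the direct sum of all fibres, so this
  is no restriction). No relation between different fibres is assumed; the total space is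
  \<open>{(p, v). v \<in> V p}\<close>. The model fibre \<open>\<real>\<^sup>r\<close> is realised by sequences vanishing from \<open>r\<close> on. A local
  trivialization is a pair \<open>(U, \<Phi>)\<close> with linear bijections \<open>\<Phi> p : V p \<rightarrow> \<real>\<^sup>r\<close> for \<open>p \<in> U\<close>; the
  transition functions \<open>U \<inter> U' \<rightarrow> GL(r)\<close> have to be smooth, which is stated for their matrix
  entries.\<close>

type_synonym ('m, 'w) triv = "'m set \<times> ('m \<Rightarrow> 'w \<Rightarrow> nat \<Rightarrow> real)"

definition model_fibre :: "nat \<Rightarrow> (nat \<Rightarrow> real) set" where
  "model_fibre r = {a. \<forall>i\<ge>r. a i = 0}"

definition vector_bundle ::
    "('m::topological_space, 'e::real_normed_vector) chart set \<Rightarrow> nat \<Rightarrow>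
     ('m \<Rightarrow> 'w::real_vector set) \<Rightarrow> ('m, 'w) triv set \<Rightarrow> bool" where
  "vector_bundle A r V T \<longleftrightarrow>
     (\<forall>p. subspace (V p)) \<and>
     (\<Union>t\<in>T. fst t) = UNIV \<and>
     (\<forall>(U, \<Phi>)\<in>T. open U \<and>
        (\<forall>p\<in>U. bij_betw (\<Phi> p) (V p) (model_fibre r) \<and>
           (\<forall>v\<in>V p. \<forall>w\<in>V p. \<forall>a b. \<Phi> p (a *\<^sub>R v + b *\<^sub>R w) = (\<lambda>i. a * \<Phi> p v i + b * \<Phi> p w i)))) \<and>
     (\<forall>(U, \<Phi>)\<in>T. \<forall>(U', \<Phi>')\<in>T. \<forall>i<r. \<forall>j<r.
        smooth_map_on A (U \<inter> U')
          (\<lambda>p. \<Phi>' p (inv_into (V p) (\<Phi> p) (\<lambda>l. if l = j then 1 else 0)) i))"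

definition smooth_sections ::
    "('m, 'e::real_normed_vector) chart set \<Rightarrow> nat \<Rightarrow> ('m \<Rightarrow> 'w set) \<Rightarrow> ('m, 'w) triv set \<Rightarrow>
     ('m \<Rightarrow> 'w) set" where
  "smooth_sections A r V T =
     {s. (\<forall>p. s p \<in> V p) \<and>
         (\<forall>(U, \<Phi>)\<in>T. \<forall>i<r. smooth_map_on A U (\<lambda>p. \<Phi> p (s p) i))}"


section \<open>Differential forms\<close>

text \<open>The value of a form at \<open>p\<close> is a function on lists of tangent vectors at \<open>p\<close>. Its degree-\<open>k\<close>
  part is the restriction to lists of length \<open>k\<close>, so a single such function represents a
  possibly inhomogeneous element of \<open>\<Omega>\<^sup>*\<close>; the sum is finite because alternating maps on more
  than \<open>dim M\<close> vectors vanish. Forms are 0 on lists that are not made of tangent vectors at \<open>p\<close>.\<close>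

type_synonym ('m, 'e, 'w) form = "'m \<Rightarrow> ('m, 'e) tangent list \<Rightarrow> 'w"

definition alternating_on ::
    "('m, 'e::real_normed_vector) tangent set \<Rightarrow> 'w::real_vector set \<Rightarrow>
     (('m, 'e) tangent list \<Rightarrow> 'w) \<Rightarrow> bool" where
  "alternating_on TM W \<alpha> \<longleftrightarrow>
     (\<forall>vs. \<alpha> vs \<in> W) \<and>
     (\<forall>vs. \<not> set vs \<subseteq> TM \<longrightarrow> \<alpha> vs = 0) \<and>
     (\<forall>us v w vs a b. set us \<subseteq> TM \<and> v \<in> TM \<and> w \<in> TM \<and> set vs \<subseteq> TM \<longrightarrow>
        \<alpha> (us @ (\<lambda>\<kappa>. a *\<^sub>R v \<kappa> + b *\<^sub>R w \<kappa>) # vs) = a *\<^sub>R \<alpha> (us @ v # vs) + b *\<^sub>R \<alpha> (us @ w # vs)) \<and>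
     (\<forall>vs i j. set vs \<subseteq> TM \<and> i < j \<and> j < length vs \<and> vs ! i = vs ! j \<longrightarrow> \<alpha> vs = 0)"

definition homogeneous :: "nat \<Rightarrow> ('m, 'e, 'w::zero) form \<Rightarrow> bool" where
  "homogeneous k \<omega> \<longleftrightarrow> (\<forall>p vs. length vs \<noteq> k \<longrightarrow> \<omega> p vs = 0)"

text \<open>\<open>\<Omega>\<^sup>*(V)\<close>; smoothness means smoothness of all components with respect to coordinate vector
  fields and local trivializations.\<close>

definition bundle_forms ::
    "('m, 'e::real_normed_vector) chart set \<Rightarrow> nat \<Rightarrow> ('m \<Rightarrow> 'w::real_vector set) \<Rightarrow>
     ('m, 'w) triv set \<Rightarrow> ('m, 'e, 'w) form set" where
  "bundle_forms A r V T =
     {\<omega>. (\<forall>p. alternating_on (tangent_space A p) (V p) (\<omega> p)) \<and>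
         (\<forall>\<kappa>\<in>A. \<forall>(U, \<Phi>)\<in>T. \<forall>i<r. \<forall>es. smooth_on (snd \<kappa> ` (fst \<kappa> \<inter> U))
            (\<lambda>x. \<Phi> (chart_inv \<kappa> x)
                   (\<omega> (chart_inv \<kappa> x) (map (coord_vec A \<kappa> (chart_inv \<kappa> x)) es)) i))}"

text \<open>\<open>\<Omega>\<^sup>k(M)\<close>.\<close>

definition scalar_forms ::
    "('m, 'e::real_normed_vector) chart set \<Rightarrow> nat \<Rightarrow> ('m, 'e, real) form set" where
  "scalar_forms A k =
     {\<tau>. homogeneous k \<tau> \<and>
         (\<forall>p. alternating_on (tangent_space A p) UNIV (\<tau> p)) \<and>
         (\<forall>\<kappa>\<in>A. \<forall>es. smooth_on (snd \<kappa> ` fst \<kappa>)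
            (\<lambda>x. \<tau> (chart_inv \<kappa> x) (map (coord_vec A \<kappa> (chart_inv \<kappa> x)) es)))}"

definition drop_nth :: "nat \<Rightarrow> 'a list \<Rightarrow> 'a list" where
  "drop_nth i vs = take i vs @ drop (Suc i) vs"

definition chart_at :: "('m, 'e) chart set \<Rightarrow> 'm \<Rightarrow> ('m, 'e) chart" where
  "chart_at A p = (SOME \<kappa>. \<kappa> \<in> A \<and> p \<in> fst \<kappa>)"

text \<open>Exterior derivative: in a chart,
  \<open>(d\<tau>)(v\<^sub>0,\<dots>,v\<^sub>k) = \<Sum>\<^sub>i (-1)\<^sup>i (\<partial>\<^bsub>v\<^sub>i\<^esub> \<tau>)(v\<^sub>0,\<dots>,v\<^sub>i omitted,\<dots>,v\<^sub>k)\<close>, the derivative being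
  taken with the other arguments extended to have constant coordinates. The result does not depend
  on the chart, for which an arbitrary one around \<open>p\<close> is chosen.\<close>

definition ext_deriv ::
    "('m, 'e::real_normed_vector) chart set \<Rightarrow> ('m, 'e, real) form \<Rightarrow> ('m, 'e, real) form" where
  "ext_deriv A \<tau> = (\<lambda>p vs. if set vs \<subseteq> tangent_space A p
     then let \<kappa> = chart_at A p in
       \<Sum>i<length vs. (-1) ^ i *
         frechet_derivative
           (\<lambda>x. \<tau> (chart_inv \<kappa> x)
                  (map (\<lambda>v. coord_vec A \<kappa> (chart_inv \<kappa> x) (v \<kappa>)) (drop_nth i vs)))
           (at (snd \<kappa> p)) ((vs ! i) \<kappa>)
     else 0)"

definition function_form :: "('m \<Rightarrow> real) \<Rightarrow> ('m, 'e, real) form" where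
  "function_form f = (\<lambda>p vs. if vs = [] then f p else 0)"

text \<open>\<open>\<tau> \<otimes> s\<close>.\<close>

definition tensor_section ::
    "('m, 'e, real) form \<Rightarrow> ('m \<Rightarrow> 'w::real_vector) \<Rightarrow> ('m, 'e, 'w) form" where
  "tensor_section \<tau> s = (\<lambda>p vs. \<tau> p vs *\<^sub>R s p)"

text \<open>\<open>\<tau> \<and> \<eta>\<close> for a \<open>k\<close>-form \<open>\<tau>\<close> and a \<open>V\<close>-valued 1-form \<open>\<eta>\<close>, by the shuffle formula (determinant
  convention): a \<open>(k,1)\<close>-shuffle is given by the index \<open>i\<close> moved to the last of the \<open>k + 1\<close> places,
  and has sign \<open>(-1)\<^bsup>k - i\<^esup>\<close>.\<close>

definition wedge_one ::
    "('m, 'e, real) form \<Rightarrow> ('m, 'e, 'w::real_vector) form \<Rightarrow> ('m, 'e, 'w) form" where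
  "wedge_one \<tau> \<eta> = (\<lambda>p vs. \<Sum>i<length vs.
     ((-1) ^ (length vs - 1 - i) * \<tau> p (drop_nth i vs)) *\<^sub>R \<eta> p [vs ! i])"

text \<open>\<open>X \<lrcorner> \<omega>\<close>. On the degree-0 part this is 0.\<close>

definition contract ::
    "('m \<Rightarrow> ('m, 'e) tangent) \<Rightarrow> ('m, 'e, 'w) form \<Rightarrow> ('m, 'e, 'w) form" where
  "contract X \<omega> = (\<lambda>p vs. \<omega> p (X p # vs))"


section \<open>Connections\<close>

definition connection ::
    "('m, 'e::real_normed_vector) chart set \<Rightarrow> nat \<Rightarrow> ('m \<Rightarrow> 'w::real_vector set) \<Rightarrow>
     ('m, 'w) triv set \<Rightarrow> (('m \<Rightarrow> 'w) \<Rightarrow> ('m, 'e, 'w) form) \<Rightarrow> bool" where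
  "connection A r V T D \<longleftrightarrow>
     (\<forall>s\<in>smooth_sections A r V T. D s \<in> bundle_forms A r V T \<and> homogeneous 1 (D s)) \<and>
     (\<forall>s\<in>smooth_sections A r V T. \<forall>t\<in>smooth_sections A r V T. \<forall>a b.
        D (\<lambda>p. a *\<^sub>R s p + b *\<^sub>R t p) = (\<lambda>p vs. a *\<^sub>R D s p vs + b *\<^sub>R D t p vs)) \<and>
     (\<forall>f. \<forall>s\<in>smooth_sections A r V T. smooth_map_on A UNIV f \<longrightarrow>
        D (\<lambda>p. f p *\<^sub>R s p) =
          (\<lambda>p vs. tensor_section (ext_deriv A (function_form f)) s p vs + f p *\<^sub>R D s p vs))"

text \<open>The extension of a connection to \<open>\<Omega>\<^sup>*(V)\<close>. Around each point, \<open>\<omega>\<close> is a finite sum of forms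
  \<open>\<tau> \<otimes> s\<close> with \<open>\<tau>\<close> a homogeneous form and \<open>s\<close> a section, both smooth on all of \<open>M\<close> (extend local
  frames by cut-off functions). The value of \<open>\<nabla>\<omega>\<close> at that point is the sum of the values of
  \<open>\<nabla>(\<tau> \<otimes> s) = d\<tau> \<otimes> s + (-1)\<^sup>k \<tau> \<and> \<nabla>s\<close>; it is the same for all such decompositions.\<close>

definition cov_deriv ::
    "('m::topological_space, 'e::real_normed_vector) chart set \<Rightarrow> nat \<Rightarrow>
     ('m \<Rightarrow> 'w::real_vector set) \<Rightarrow> ('m, 'w) triv set \<Rightarrow> (('m \<Rightarrow> 'w) \<Rightarrow> ('m, 'e, 'w) form) \<Rightarrow>
     ('m, 'e, 'w) form \<Rightarrow> ('m, 'e, 'w) form" where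
  "cov_deriv A r V T D \<omega> = (\<lambda>p. THE y. \<exists>U (N::nat) k \<tau> s.
     open U \<and> p \<in> U \<and>
     (\<forall>i<N. \<tau> i \<in> scalar_forms A (k i) \<and> s i \<in> smooth_sections A r V T) \<and>
     (\<forall>q\<in>U. \<forall>vs. \<omega> q vs = (\<Sum>i<N. tensor_section (\<tau> i) (s i) q vs)) \<and>
     y = (\<lambda>vs. \<Sum>i<N. tensor_section (ext_deriv A (\<tau> i)) (s i) p vs
                    + (-1) ^ k i *\<^sub>R wedge_one (\<tau> i) (D (s i)) p vs))"

end

theory Submission
  imports Defs
begin

text \<open>
  The identity is Cartan's formula for the contraction with a bracket: with the covariant Lie derivative
  \<open>L\<^sub>X = \<nabla> (X \<lrcorner> _) + X \<lrcorner> \<nabla>\<close>, it says that the commutator of \<open>L\<^sub>X\<close> with \<open>Y \<lrcorner> _\<close> is \<open>[X,Y] \<lrcorner> _\<close>. The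
  curvature does not enter, because \<open>\<nabla>\<close> is never applied twice in a row. The proof is therefore a computation with
  first derivatives at one point.

  Near a point \<open>p\<close> choose a chart and a frame \<open>e\<^sub>j\<close> of \<open>V\<close>, and let \<open>W\<^sub>j\<close> be the components of \<open>\<omega>\<close>, regarded as
  functions with values in the alternating maps on the model space. Then
  \<open>\<nabla>\<omega> (v\<^sub>0,\<dots>,v\<^sub>k) = \<Sum>\<^sub>j \<Sum>\<^sub>i (-1)\<^sup>i \<nabla>\<^bsub>v\<^sub>i\<^esub> (W\<^sub>j(\<dots>,v\<^sub>i omitted,\<dots>) e\<^sub>j)\<close>, the \<open>v\<^sub>i\<close> being extended with constant
  coordinates (\<open>cov_deriv_in_frame\<close>). Inserting this in the four terms and using the product rule, the derivatives of
  \<open>W\<^sub>j\<close> cancel. What remains is \<open>W\<^sub>j\<close> applied to the derivative of \<open>Y\<close> along \<open>X\<close> minus that of \<open>X\<close> along \<open>Y\<close>, which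
  is the bracket; the derivatives of \<open>X\<close> and \<open>Y\<close> along the other arguments cancel by antisymmetry
  (\<open>cartan_formula_local\<close>).

  The work lies in the formula for \<open>\<nabla>\<omega>\<close>. Since \<open>\<nabla>\<close> is defined by decompositions of \<open>\<omega>\<close> near \<open>p\<close> into products of
  global forms and global sections, such decompositions have to be constructed (\<open>form_decomposition\<close>), and the value
  has to be independent of them. Both need smooth bump functions on \<open>M\<close> (\<open>bump_function\<close>), which give global sections
  restricting to a frame near \<open>p\<close> (\<open>local_frame\<close>) and make the connection a local operator (\<open>connection_local\<close>).

  Finally, \<open>\<omega>\<close> can be evaluated on the bracket through its coordinates only because the bracket is a tangent
  vector, that is, because its coordinates transform correctly. This rests on the symmetry of second derivatives of the transition maps
  (\<open>lie_bracket_tangent\<close>).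
\<close>


section \<open>Calculus of smooth maps\<close>

lemma has_frechet_derivative:
  "f differentiable (at x) \<Longrightarrow> (f has_derivative frechet_derivative f (at x)) (at x)"
  using frechet_derivative_works by blast

lemma frechet_derivative_apply:
  "(f has_derivative f') (at x) \<Longrightarrow> frechet_derivative f (at x) v = f' v"
  using frechet_derivative_at by metis

lemma Ck_on_cong:
  assumes "open S" "Ck_on n S f" "\<And>x. x \<in> S \<Longrightarrow> f x = g x"
  shows "Ck_on n S g"
  using assms(2,3)
proof (induction n arbitrary: f g)
  case 0
  then show ?case using continuous_on_cong[of S S f g] by simp
next
  case (Suc n)
  have d: "f differentiable (at x)" if "x \<in> S" for x
    using Suc.prems that by simp
  have dg: "g differentiable (at x)" if "x \<in> S" for x
    using d[OF that] has_derivative_transform_within_open[OF _ assms(1) that, of f _ UNIV g] Suc.prems(2)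
    unfolding differentiable_def by auto
  have eq: "frechet_derivative f (at x) = frechet_derivative g (at x)" if "x \<in> S" for x
    using frechet_derivative_transform_within_open[OF d[OF that] assms(1) that] Suc.prems(2) by blast
  have "Ck_on n S (\<lambda>x. frechet_derivative g (at x) v)" for v
    by (rule Suc.IH[of "\<lambda>x. frechet_derivative f (at x) v"]) (use Suc.prems eq in auto)
  with dg show ?case by simp
qed

text \<open>The recursion in \<open>Ck_on\<close> asks for differentiability at order \<open>n + 1\<close> but for continuity at order \<open>0\<close>
  only, so the orders are nested because differentiable maps are continuous.\<close>

lemma Ck_on_Suc_imp: "Ck_on (Suc n) S f \<Longrightarrow> Ck_on n S f"
proof (induction n arbitrary: f)
  case 0
  then show ?case
    by (auto intro!: continuous_at_imp_continuous_on differentiable_imp_continuous_within)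
next
  case (Suc n)
  then show ?case by (metis Ck_on.simps(2))
qed

lemma Ck_on_subset: "Ck_on n S f \<Longrightarrow> S' \<subseteq> S \<Longrightarrow> Ck_on n S' f"
  by (induction n arbitrary: f) (auto intro: continuous_on_subset)

lemma Ck_on_Union:
  assumes "\<And>S. S \<in> \<S> \<Longrightarrow> open S" "\<And>S. S \<in> \<S> \<Longrightarrow> Ck_on n S f"
  shows "Ck_on n (\<Union>\<S>) f"
  using assms(2)
proof (induction n arbitrary: f)
  case 0
  then show ?case using continuous_on_open_Union[of \<S> f] assms(1) by auto
next
  case (Suc n)
  then show ?case by auto
qed

text \<open>The derivative is prescribed through a formula \<open>f'\<close> valid on \<open>S\<close>, so that the closure properties below follow by
  induction on the order from the corresponding differentiation rules.\<close>

lemma Ck_on_SucI: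
  assumes "open S" "\<And>x. x \<in> S \<Longrightarrow> (f has_derivative f' x) (at x)"
    and "\<And>v. Ck_on n S (\<lambda>x. f' x v)"
  shows "Ck_on (Suc n) S f"
proof -
  have "frechet_derivative f (at x) = f' x" if "x \<in> S" for x
    using frechet_derivative_at[OF assms(2)[OF that]] by simp
  then have "Ck_on n S (\<lambda>x. frechet_derivative f (at x) v)" for v
    using Ck_on_cong[OF assms(1) assms(3)[of v]] by simp
  with assms(2) show ?thesis
    by (auto simp: differentiable_def)
qed

lemma Ck_on_SucD:
  assumes "Ck_on (Suc n) S f"
  shows "x \<in> S \<Longrightarrow> (f has_derivative frechet_derivative f (at x)) (at x)"
    and "Ck_on n S (\<lambda>x. frechet_derivative f (at x) v)"
  using assms has_frechet_derivative by auto

lemma Ck_on_const: "open S \<Longrightarrow> Ck_on n S (\<lambda>x. c)"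
proof (induction n arbitrary: c)
  case (Suc n)
  show ?case
    by (rule Ck_on_SucI[OF Suc.prems has_derivative_const]) (rule Suc.IH[OF Suc.prems])
qed simp

lemma Ck_on_add:
  assumes "open S"
  shows "Ck_on n S f \<Longrightarrow> Ck_on n S g \<Longrightarrow> Ck_on n S (\<lambda>x. f x + g x)"
proof (induction n arbitrary: f g)
  case 0
  then show ?case by (auto intro: continuous_on_add)
next
  case (Suc n)
  show ?case
    by (rule Ck_on_SucI[OF assms has_derivative_add])
       (rule Ck_on_SucD(1)[OF Suc.prems(1)] Ck_on_SucD(1)[OF Suc.prems(2)]
          Suc.IH[OF Ck_on_SucD(2)[OF Suc.prems(1)] Ck_on_SucD(2)[OF Suc.prems(2)]]; assumption)+
qed

lemma Ck_on_linear:
  assumes "open S" "bounded_linear L"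
  shows "Ck_on n S f \<Longrightarrow> Ck_on n S (\<lambda>x. L (f x))"
proof (induction n arbitrary: f)
  case 0
  then show ?case using bounded_linear.continuous_on[OF assms(2)] by auto
next
  case (Suc n)
  show ?case
    by (rule Ck_on_SucI[OF assms(1) bounded_linear.has_derivative[OF assms(2)]])
       (rule Ck_on_SucD(1)[OF Suc.prems] Suc.IH[OF Ck_on_SucD(2)[OF Suc.prems]]; assumption)+
qed

lemma Ck_on_bilinear:
  assumes "open S" "bounded_bilinear m"
  shows "Ck_on n S f \<Longrightarrow> Ck_on n S g \<Longrightarrow> Ck_on n S (\<lambda>x. m (f x) (g x))"
proof (induction n arbitrary: f g)
  case 0
  then show ?case using bounded_bilinear.continuous_on[OF assms(2)] by auto
next
  case (Suc n)
  show ?case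
    by (rule Ck_on_SucI[OF assms(1) bounded_bilinear.FDERIV[OF assms(2)]])
       (rule Ck_on_SucD(1)[OF Suc.prems(1)] Ck_on_SucD(1)[OF Suc.prems(2)] Ck_on_add[OF assms(1)]
          Suc.IH[OF Ck_on_Suc_imp[OF Suc.prems(1)] Ck_on_SucD(2)[OF Suc.prems(2)]]
          Suc.IH[OF Ck_on_SucD(2)[OF Suc.prems(1)] Ck_on_Suc_imp[OF Suc.prems(2)]]; assumption?)+
qed

text \<open>When \<open>f\<close> is real valued, the chain rule writes the derivative as the product of a derivative of \<open>f\<close> with
  \<open>h' \<circ> f\<close>, to which the induction hypothesis applies with \<open>h'\<close> in place of \<open>h\<close>.\<close>

lemma Ck_on_compose_real:
  fixes h :: "real \<Rightarrow> 'b::real_normed_vector"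
  assumes "open S"
  shows "(\<And>k. Ck_on k UNIV h) \<Longrightarrow> Ck_on n S f \<Longrightarrow> Ck_on n S (\<lambda>x. h (f x))"
proof (induction n arbitrary: h f)
  case 0
  have "continuous_on UNIV h" using 0(1)[of 0] by simp
  with 0(2) show ?case using continuous_on_compose2[of UNIV h S f] by simp
next
  case (Suc n)
  let ?h' = "\<lambda>t. frechet_derivative h (at t) 1"
  have h: "(h has_derivative (\<lambda>s. s *\<^sub>R ?h' t)) (at t)" for t
  proof -
    have d: "(h has_derivative frechet_derivative h (at t)) (at t)"
      using Ck_on_SucD(1)[OF Suc.prems(1)] by blast
    have "frechet_derivative h (at t) s = s *\<^sub>R ?h' t" for s
      using linear_scale[OF has_derivative_linear[OF d], of s 1] by simp
    then have "frechet_derivative h (at t) = (\<lambda>s. s *\<^sub>R ?h' t)" by blast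
    with d show ?thesis by simp
  qed
  have h': "Ck_on k UNIV ?h'" for k
    using Ck_on_SucD(2)[OF Suc.prems(1)] by simp
  show ?case
  proof (rule Ck_on_SucI[OF assms])
    fix x assume "x \<in> S"
    show "((\<lambda>x. h (f x)) has_derivative
        (\<lambda>v. frechet_derivative f (at x) v *\<^sub>R ?h' (f x))) (at x)"
      using diff_chain_at[OF Ck_on_SucD(1)[OF Suc.prems(2) \<open>x \<in> S\<close>] h] by (simp add: o_def)
  next
    fix v
    show "Ck_on n S (\<lambda>x. frechet_derivative f (at x) v *\<^sub>R ?h' (f x))"
      by (rule Ck_on_bilinear[OF assms bounded_bilinear_scaleR])
         (rule Ck_on_SucD(2)[OF Suc.prems(2)] Suc.IH[OF h' Ck_on_Suc_imp[OF Suc.prems(2)]])+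
  qed
qed

lemma smooth_on_cong: "open S \<Longrightarrow> smooth_on S f \<Longrightarrow> (\<And>x. x \<in> S \<Longrightarrow> f x = g x) \<Longrightarrow> smooth_on S g"
  unfolding smooth_on_def using Ck_on_cong by blast

lemma smooth_on_subset: "smooth_on S f \<Longrightarrow> S' \<subseteq> S \<Longrightarrow> smooth_on S' f"
  unfolding smooth_on_def using Ck_on_subset by blast

lemma smooth_on_Un:
  "open S \<Longrightarrow> open S' \<Longrightarrow> smooth_on S f \<Longrightarrow> smooth_on S' f \<Longrightarrow> smooth_on (S \<union> S') f"
  using Ck_on_Union[of "{S, S'}" _ f] unfolding smooth_on_def by auto

lemma smooth_on_const: "open S \<Longrightarrow> smooth_on S (\<lambda>x. c)"
  unfolding smooth_on_def using Ck_on_const by blast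

lemma smooth_on_add:
  "open S \<Longrightarrow> smooth_on S f \<Longrightarrow> smooth_on S g \<Longrightarrow> smooth_on S (\<lambda>x. f x + g x)"
  unfolding smooth_on_def using Ck_on_add by blast

lemma smooth_on_linear:
  "open S \<Longrightarrow> bounded_linear L \<Longrightarrow> smooth_on S f \<Longrightarrow> smooth_on S (\<lambda>x. L (f x))"
  unfolding smooth_on_def using Ck_on_linear by blast

lemma smooth_on_bilinear:
  "open S \<Longrightarrow> bounded_bilinear m \<Longrightarrow> smooth_on S f \<Longrightarrow> smooth_on S g
    \<Longrightarrow> smooth_on S (\<lambda>x. m (f x) (g x))"
  unfolding smooth_on_def using Ck_on_bilinear by blast

lemma smooth_on_mult:
  fixes f g :: "'a::real_normed_vector \<Rightarrow> real"
  shows "open S \<Longrightarrow> smooth_on S f \<Longrightarrow> smooth_on S g \<Longrightarrow> smooth_on S (\<lambda>x. f x * g x)"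
  by (rule smooth_on_bilinear[OF _ bounded_bilinear_mult])

lemma smooth_on_sum:
  assumes "open S" "\<And>i. i \<in> I \<Longrightarrow> smooth_on S (f i)"
  shows "smooth_on S (\<lambda>x. \<Sum>i\<in>I. f i x)"
proof (cases "finite I")
  case True
  then show ?thesis
    using assms(2) by induction (auto intro: smooth_on_const smooth_on_add assms(1))
qed (simp add: smooth_on_const assms(1))

lemma smooth_on_compose_real:
  fixes h :: "real \<Rightarrow> 'b::real_normed_vector"
  shows "open S \<Longrightarrow> smooth_on UNIV h \<Longrightarrow> smooth_on S f \<Longrightarrow> smooth_on S (\<lambda>x. h (f x))"
  unfolding smooth_on_def using Ck_on_compose_real by blast

lemma smooth_on_differentiable: "smooth_on S f \<Longrightarrow> x \<in> S \<Longrightarrow> f differentiable (at x)"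
  unfolding smooth_on_def using Ck_on.simps(2) by blast

lemma smooth_on_has_derivative:
  "smooth_on S f \<Longrightarrow> x \<in> S \<Longrightarrow> (f has_derivative frechet_derivative f (at x)) (at x)"
  using smooth_on_differentiable has_frechet_derivative by blast

lemma smooth_on_frechet_derivative:
  "smooth_on S f \<Longrightarrow> smooth_on S (\<lambda>x. frechet_derivative f (at x) v)"
  unfolding smooth_on_def using Ck_on.simps(2) by blast


subsection \<open>A smooth cutoff function of one variable\<close>

definition flat_exp :: "real \<Rightarrow> real" where
  "flat_exp t = (if t > 0 then exp (- (1 / t)) else 0)"

text \<open>The functions \<open>P(1/t) exp(-1/t)\<close>, extended by \<open>0\<close> to \<open>t \<le> 0\<close>, form a family containing \<open>flat_exp\<close> and
  closed under differentiation.\<close>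

definition flat_poly :: "real poly \<Rightarrow> real \<Rightarrow> real" where
  "flat_poly P t = (if t > 0 then poly P (1 / t) * exp (- (1 / t)) else 0)"

lemma tendsto_poly_exp_at_top: "((\<lambda>x::real. poly P x * exp (- x)) \<longlongrightarrow> 0) at_top"
proof -
  have "((\<lambda>x::real. \<Sum>i\<le>degree P. coeff P i * (x ^ i / exp x)) \<longlongrightarrow> (\<Sum>i\<le>degree P. coeff P i * 0)) at_top"
    by (intro tendsto_sum tendsto_mult tendsto_const tendsto_power_div_exp_0)
  then show ?thesis
    by (simp add: poly_altdef exp_minus field_simps sum_distrib_left)
qed

lemma flat_poly_has_derivative:
  "(flat_poly P has_field_derivative flat_poly ([:0, 0, 1:] * (P - pderiv P)) t) (at t)"
proof -
  consider "t > 0" | "t < 0" | "t = 0" by linarith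
  then show ?thesis
  proof cases
    case 1
    have "((\<lambda>t. poly P (1 / t) * exp (- (1 / t))) has_field_derivative
        poly ([:0, 0, 1:] * (P - pderiv P)) (1 / t) * exp (- (1 / t))) (at t)"
      using 1 by (auto intro!: derivative_eq_intros poly_DERIV[THEN DERIV_chain2]
          simp: field_simps power2_eq_square)
    then have "(flat_poly P has_field_derivative
        poly ([:0, 0, 1:] * (P - pderiv P)) (1 / t) * exp (- (1 / t))) (at t)"
      by (rule has_field_derivative_transform_within_open[where S = "{0<..}"])
         (use 1 in \<open>auto simp: flat_poly_def\<close>)
    then show ?thesis using 1 by (simp add: flat_poly_def)
  next
    case 2
    have "((\<lambda>t::real. 0) has_field_derivative 0) (at t)" by simp
    then have "(flat_poly P has_field_derivative 0) (at t)"
      by (rule has_field_derivative_transform_within_open[where S = "{..<0}"])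
         (use 2 in \<open>auto simp: flat_poly_def\<close>)
    then show ?thesis using 2 by (simp add: flat_poly_def)
  next
    case 3
    (* for t > 0 the difference quotient at 0 is x P(x) exp(-x) with x = 1/t *)
    have "((\<lambda>x. poly ([:0, 1:] * P) x * exp (- x)) \<longlongrightarrow> 0) at_top"
      by (rule tendsto_poly_exp_at_top)
    then have "((\<lambda>t. poly ([:0, 1:] * P) (inverse t) * exp (- inverse t)) \<longlongrightarrow> 0) (at_right 0)"
      by (rule filterlim_compose[OF _ filterlim_inverse_at_top_right])
    then have "((\<lambda>t. flat_poly P t / t) \<longlongrightarrow> 0) (at_right 0)"
      by (rule Lim_transform_eventually)
         (auto simp: eventually_at_filter flat_poly_def field_simps)
    moreover have "((\<lambda>t. flat_poly P t / t) \<longlongrightarrow> 0) (at_left 0)"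
      by (rule Lim_transform_eventually[OF tendsto_const])
         (auto simp: eventually_at_filter flat_poly_def)
    ultimately have "((\<lambda>t. flat_poly P t / t) \<longlongrightarrow> 0) (at 0)"
      using filterlim_split_at by blast
    then show ?thesis using 3
      by (simp add: has_field_derivative_iff flat_poly_def)
  qed
qed

lemma Ck_on_flat_poly: "Ck_on n UNIV (flat_poly P)"
proof (induction n arbitrary: P)
  case 0
  show ?case
    using DERIV_isCont[OF flat_poly_has_derivative] by (simp add: continuous_on_eq_continuous_at)
next
  case (Suc n)
  show ?case
    by (rule Ck_on_SucI[OF open_UNIV flat_poly_has_derivative[unfolded has_field_derivative_def]])
       (rule Ck_on_bilinear[OF open_UNIV bounded_bilinear_mult Suc Ck_on_const[OF open_UNIV]])
qed

lemma smooth_flat_exp: "smooth_on UNIV flat_exp"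
proof -
  have "flat_exp = flat_poly 1" by (auto simp: flat_exp_def flat_poly_def)
  then show ?thesis unfolding smooth_on_def using Ck_on_flat_poly by metis
qed

text \<open>Nesting \<open>flat_exp\<close> gives a plateau without any division: for \<open>t \<le> 0\<close> the inner value is
  \<open>0\<close> and the outer one is \<open>exp (-1)\<close>; for \<open>t \<ge> 1\<close> the inner value is at least \<open>exp (-1)\<close>,
  so the outer argument is not positive.\<close>

lemma smooth_cutoff_exists:
  obtains h :: "real \<Rightarrow> real" where "smooth_on UNIV h"
    "\<And>t. t \<le> 0 \<Longrightarrow> h t = 1" "\<And>t. t \<ge> 1 \<Longrightarrow> h t = 0"
proof
  let ?h = "\<lambda>t. exp 1 * flat_exp (1 + (- exp 1) * flat_exp t)"
  show "smooth_on UNIV ?h"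
    by (intro smooth_on_mult smooth_on_compose_real[OF _ smooth_flat_exp] smooth_on_add
        smooth_on_const smooth_flat_exp open_UNIV)
  show "?h t = 1" if "t \<le> 0" for t
    using that by (simp add: flat_exp_def flip: exp_add)
  show "?h t = 0" if "t \<ge> 1" for t
  proof -
    have "exp 1 * flat_exp t = exp (1 - 1 / t)"
      using that by (simp add: flat_exp_def flip: exp_add)
    moreover have "1 - 1 / t \<ge> 0" using that by simp
    ultimately have "exp 1 * flat_exp t \<ge> 1" by (metis one_le_exp_iff)
    then show ?thesis by (simp add: flat_exp_def)
  qed
qed


section \<open>Finite-dimensional inner product spaces\<close>

definition parseval_frame :: "'a::real_inner set \<Rightarrow> bool" where
  "parseval_frame B \<longleftrightarrow> finite B \<and> (\<forall>x. (\<Sum>b\<in>B. (x \<bullet> b) *\<^sub>R b) = x)"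

lemma parseval_frame_exists:
  assumes "finite (B0::'a::real_inner set)" "span B0 = UNIV"
  obtains B where "parseval_frame (B::'a set)"
proof -
  obtain C :: "'a set" where C: "finite C" "span C = UNIV" "pairwise orthogonal C"
    using basis_orthogonal[OF assms(1)] assms(2) by auto
  let ?B = "(\<lambda>x. x /\<^sub>R norm x) ` (C - {0})"
  have "C \<subseteq> span ?B"
  proof
    fix x assume x: "x \<in> C"
    show "x \<in> span ?B"
    proof (cases "x = 0")
      case False
      then have "x /\<^sub>R norm x \<in> span ?B" using x by (intro span_base) auto
      from span_scale[OF this, of "norm x"] False show ?thesis
        by (simp only: scaleR_scaleR) simp
    qed (simp add: span_0)
  qed
  then have sp: "span ?B = UNIV"
    using C(2) span_minimal[of C "span ?B"] subspace_span by auto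
  have fin: "finite ?B" using C(1) by simp
  have nrm: "norm b = 1" if "b \<in> ?B" for b
  proof -
    from that obtain x where "x \<noteq> 0" "b = x /\<^sub>R norm x" by auto
    then show ?thesis by simp
  qed
  have po: "pairwise orthogonal ?B"
    using C(3) unfolding pairwise_def by (auto simp: orthogonal_def)
  have "(\<Sum>b\<in>?B. (x \<bullet> b) *\<^sub>R b) = x" for x
    by (rule orthonormal_basis_expand[OF po nrm _ fin]) (auto simp: sp)
  with fin have "parseval_frame ?B" by (auto simp: parseval_frame_def)
  then show ?thesis by (rule that)
qed

text \<open>A ball is a closed subset of a box, which
  is built one coordinate at a time as a continuous image of a product of compact sets.\<close>

lemma compact_cball_frame:
  fixes c :: "'a::real_inner"
  assumes "parseval_frame (B::'a set)"
  shows "compact (cball c R)"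
proof -
  have fin: "finite B" and ex: "\<And>x. (\<Sum>b\<in>B. (x \<bullet> b) *\<^sub>R b) = x"
    using assms by (auto simp: parseval_frame_def)
  have box: "\<exists>K. compact K \<and> (\<forall>x\<in>cball c R. (\<Sum>b\<in>F. (x \<bullet> b) *\<^sub>R b) \<in> K)" if "finite F" for F :: "'a set"
    using that
  proof induction
    case empty
    show ?case by (intro exI[of _ "{0}"]) auto
  next
    case (insert b F)
    then obtain K where K: "compact K" "\<forall>x\<in>cball c R. (\<Sum>b\<in>F. (x \<bullet> b) *\<^sub>R b) \<in> K" by auto
    let ?r = "(norm c + \<bar>R\<bar>) * norm b"
    let ?K = "(\<lambda>(a, y). a *\<^sub>R b + y) ` ({- ?r .. ?r} \<times> K)"
    have "compact ?K"
      unfolding case_prod_beta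
      by (intro compact_continuous_image continuous_intros compact_Times K compact_Icc)
    moreover have "(\<Sum>b\<in>insert b F. (x \<bullet> b) *\<^sub>R b) \<in> ?K" if "x \<in> cball c R" for x
    proof -
      have "norm x \<le> norm c + \<bar>R\<bar>"
        using that norm_triangle_ineq4[of c "c - x"] by (simp add: dist_norm)
      then have "\<bar>x \<bullet> b\<bar> \<le> ?r"
        using order_trans[OF Cauchy_Schwarz_ineq2 mult_right_mono[OF _ norm_ge_zero]] by blast
      then have "(x \<bullet> b, \<Sum>b\<in>F. (x \<bullet> b) *\<^sub>R b) \<in> {- ?r .. ?r} \<times> K"
        using K(2) that by auto
      then show ?thesis
        using insert.hyps by (auto intro!: image_eqI[of _ _ "(x \<bullet> b, \<Sum>b\<in>F. (x \<bullet> b) *\<^sub>R b)"])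
    qed
    ultimately show ?case by blast
  qed
  then obtain K where "compact K" "cball c R \<subseteq> K"
    using box[OF fin] ex by (metis subsetI)
  then show ?thesis
    using compact_Int_closed[of K "cball c R"] by (simp add: Int_absorb1)
qed

text \<open>The mean value theorem, applied first along \<open>u\<close> to the difference in direction \<open>v\<close>, and then along
  \<open>v\<close> to the derivative in direction \<open>u\<close>.\<close>

lemma second_difference_mvt:
  fixes f :: "'a::real_normed_vector \<Rightarrow> real"
  assumes f: "\<And>y. y \<in> S \<Longrightarrow> (f has_derivative f' y) (at y)"
    and f': "\<And>y. y \<in> S \<Longrightarrow> ((\<lambda>y. f' y u) has_derivative f'' y) (at y)"
    and h: "0 < (h::real)"
    and S: "\<And>s t. 0 \<le> s \<Longrightarrow> s \<le> h \<Longrightarrow> 0 \<le> t \<Longrightarrow> t \<le> h \<Longrightarrow> x + s *\<^sub>R u + t *\<^sub>R v \<in> S"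
  obtains s t where "0 < s" "s < h" "0 < t" "t < h"
    "f (x + h *\<^sub>R u + h *\<^sub>R v) - f (x + h *\<^sub>R u) - f (x + h *\<^sub>R v) + f x
      = h * h * f'' (x + s *\<^sub>R u + t *\<^sub>R v) v"
proof -
  let ?g = "\<lambda>s. f (x + s *\<^sub>R u + h *\<^sub>R v) - f (x + s *\<^sub>R u + 0 *\<^sub>R v)"
  have d1: "((\<lambda>s. f (x + s *\<^sub>R u + t *\<^sub>R v)) has_derivative (\<lambda>k. f' (x + s *\<^sub>R u + t *\<^sub>R v) (k *\<^sub>R u)))
      (at s within {0..h})" if "0 \<le> s" "s \<le> h" "0 \<le> t" "t \<le> h" for s t
    by (rule has_derivative_compose[where g = f and f = "\<lambda>s. x + s *\<^sub>R u + t *\<^sub>R v", OF _ f[OF S[OF that]]])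
       (auto intro!: derivative_eq_intros)
  have "\<exists>s\<in>{0<..<h}. ?g h - ?g 0 =
      f' (x + s *\<^sub>R u + h *\<^sub>R v) ((h - 0) *\<^sub>R u) - f' (x + s *\<^sub>R u + 0 *\<^sub>R v) ((h - 0) *\<^sub>R u)"
    by (rule mvt_simple[OF h]) (intro has_derivative_diff d1, use h in auto)
  then obtain s where s: "0 < s" "s < h" and
    gs: "?g h - ?g 0 = f' (x + s *\<^sub>R u + h *\<^sub>R v) (h *\<^sub>R u) - f' (x + s *\<^sub>R u + 0 *\<^sub>R v) (h *\<^sub>R u)"
    by auto
  have lin: "f' (x + s *\<^sub>R u + t *\<^sub>R v) (h *\<^sub>R u) = h * f' (x + s *\<^sub>R u + t *\<^sub>R v) u"
    if "0 \<le> t" "t \<le> h" for t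
    using linear_scale[OF has_derivative_linear[OF f[OF S[of s t]]], of h u] s that by simp
  have d2: "((\<lambda>t. f' (x + s *\<^sub>R u + t *\<^sub>R v) u) has_derivative (\<lambda>k. f'' (x + s *\<^sub>R u + t *\<^sub>R v) (k *\<^sub>R v)))
      (at t within {0..h})" if "0 \<le> t" "t \<le> h" for t
    by (rule has_derivative_compose[where g = "\<lambda>y. f' y u" and f = "\<lambda>t. x + s *\<^sub>R u + t *\<^sub>R v", OF _ f'[OF S]])
       (use s that in \<open>auto intro!: derivative_eq_intros\<close>)
  obtain t where t: "0 < t" "t < h" and
    gt: "f' (x + s *\<^sub>R u + h *\<^sub>R v) u - f' (x + s *\<^sub>R u + 0 *\<^sub>R v) u
      = f'' (x + s *\<^sub>R u + t *\<^sub>R v) ((h - 0) *\<^sub>R v)"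
    using mvt_simple[OF h d2] by auto
  have "f'' (x + s *\<^sub>R u + t *\<^sub>R v) (h *\<^sub>R v) = h * f'' (x + s *\<^sub>R u + t *\<^sub>R v) v"
    using linear_scale[OF has_derivative_linear[OF f'[OF S[of s t]]], of h v] s t by simp
  then have "?g h - ?g 0 = h * h * f'' (x + s *\<^sub>R u + t *\<^sub>R v) v"
    using gs gt lin[of h] lin[of 0] h by (simp add: algebra_simps)
  then show ?thesis by (intro that[OF s t]) simp
qed

text \<open>Both iterated derivatives are limits of one and the same second difference quotient, which is
  symmetric in the two directions; this is Schwarz's theorem.\<close>

lemma second_derivative_symmetric_real:
  fixes f :: "'a::real_normed_vector \<Rightarrow> real"
  assumes "open S" "smooth_on S f" "x \<in> S"
  shows "frechet_derivative (\<lambda>y. frechet_derivative f (at y) u) (at x) v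
       = frechet_derivative (\<lambda>y. frechet_derivative f (at y) v) (at x) u"
    (is "?D u v x = ?D v u x")
proof (rule ccontr)
  assume ne: "\<not> ?thesis"
  define e where "e = \<bar>?D u v x - ?D v u x\<bar> / 2"
  have e: "e > 0" using ne by (simp add: e_def)
  have sm: "smooth_on S (?D a b)" for a b
    by (intro smooth_on_frechet_derivative assms)
  have cont: "(?D a b \<longlongrightarrow> ?D a b x) (nhds x)" for a b
    using differentiable_imp_continuous_within[OF smooth_on_differentiable[OF sm assms(3), of a b]]
      tendsto_at_iff_tendsto_nhds[of "?D a b" x]
    by (simp add: continuous_within)
  have "eventually (\<lambda>y. y \<in> S \<and> dist (?D u v y) (?D u v x) < e \<and> dist (?D v u y) (?D v u x) < e) (nhds x)"
    by (intro eventually_conj eventually_nhds_in_open assms tendstoD[OF cont e])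
  then obtain d where d: "d > 0" and
    near: "\<And>y. dist y x < d \<Longrightarrow> y \<in> S \<and> dist (?D u v y) (?D u v x) < e \<and> dist (?D v u y) (?D v u x) < e"
    unfolding eventually_nhds_metric by blast
  (* the added 1 keeps N positive when both directions vanish *)
  define N where "N = norm u + norm v + 1"
  define h where "h = d / (2 * N)"
  have nn: "N > 0" by (simp add: N_def add_nonneg_pos)
  have h: "h > 0" using d nn by (simp add: h_def)
  have hd: "h * (norm u + norm v) < d"
  proof -
    have "h * N = d / 2" using nn by (simp add: h_def)
    then show ?thesis using h d by (simp add: N_def algebra_simps)
  qed
  have close: "dist (x + s *\<^sub>R a + t *\<^sub>R b) x < d"
    if "0 \<le> s" "s \<le> h" "0 \<le> t" "t \<le> h" "norm a + norm b = norm u + norm v" for s t and a b :: 'a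
  proof -
    have "dist (x + s *\<^sub>R a + t *\<^sub>R b) x \<le> s * norm a + t * norm b"
      using norm_triangle_ineq[of "s *\<^sub>R a" "t *\<^sub>R b"] that by (simp add: dist_norm algebra_simps)
    also have "\<dots> \<le> h * norm a + h * norm b"
      using that by (intro add_mono mult_right_mono) auto
    also have "\<dots> = h * (norm u + norm v)"
      using that(5) by (simp flip: distrib_left)
    finally show ?thesis using hd by simp
  qed
  have mv: "\<exists>y. dist y x < d \<and>
      f (x + h *\<^sub>R a + h *\<^sub>R b) - f (x + h *\<^sub>R a) - f (x + h *\<^sub>R b) + f x = h * h * ?D a b y"
    if ab: "norm a + norm b = norm u + norm v" for a b
  proof -
    obtain s t where "0 < s" "s < h" "0 < t" "t < h" and
      "f (x + h *\<^sub>R a + h *\<^sub>R b) - f (x + h *\<^sub>R a) - f (x + h *\<^sub>R b) + f x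
        = h * h * ?D a b (x + s *\<^sub>R a + t *\<^sub>R b)"
      by (rule second_difference_mvt[where S = "{y. dist y x < d}" and x = x and u = a and v = b,
            OF smooth_on_has_derivative[OF assms(2)]
               smooth_on_has_derivative[OF smooth_on_frechet_derivative[OF assms(2)]] h])
         (use near close ab in auto)
    then show ?thesis using close[of s t a b] ab by auto
  qed
  obtain y where y: "dist y x < d"
    "f (x + h *\<^sub>R u + h *\<^sub>R v) - f (x + h *\<^sub>R u) - f (x + h *\<^sub>R v) + f x = h * h * ?D u v y"
    using mv[of u v] by auto
  obtain z where z: "dist z x < d"
    "f (x + h *\<^sub>R v + h *\<^sub>R u) - f (x + h *\<^sub>R v) - f (x + h *\<^sub>R u) + f x = h * h * ?D v u z"
    using mv[of v u] by auto
  have "h * h * ?D u v y = h * h * ?D v u z"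
  proof -
    have "f (x + h *\<^sub>R v + h *\<^sub>R u) = f (x + h *\<^sub>R u + h *\<^sub>R v)" by (simp add: add_ac)
    with y(2) z(2) show ?thesis by linarith
  qed
  then have "?D u v y = ?D v u z" using h by simp
  moreover have "\<bar>?D u v y - ?D u v x\<bar> < e" "\<bar>?D v u z - ?D v u x\<bar> < e"
    using near[OF y(1)] near[OF z(1)] by (simp_all add: dist_real_def)
  ultimately show False unfolding e_def by argo
qed

lemma second_derivative_symmetric:
  fixes f :: "'a::real_normed_vector \<Rightarrow> 'b::real_inner"
  assumes "open S" "smooth_on S f" "x \<in> S"
  shows "frechet_derivative (\<lambda>y. frechet_derivative f (at y) u) (at x) v
       = frechet_derivative (\<lambda>y. frechet_derivative f (at y) v) (at x) u"
proof -
  have ip: "frechet_derivative (\<lambda>y. g y \<bullet> w) (at y) = (\<lambda>h. frechet_derivative g (at y) h \<bullet> w)"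
    if "smooth_on S g" "y \<in> S" for g :: "'a \<Rightarrow> 'b" and w y
    using frechet_derivative_at[OF has_derivative_inner_left[OF smooth_on_has_derivative[OF that]]] by simp
  have two: "frechet_derivative (\<lambda>y. frechet_derivative (\<lambda>y. f y \<bullet> w) (at y) a) (at x) b
      = frechet_derivative (\<lambda>y. frechet_derivative f (at y) a) (at x) b \<bullet> w" for w a b
  proof -
    have s: "smooth_on S (\<lambda>y. frechet_derivative f (at y) a \<bullet> w)"
      by (intro smooth_on_linear[OF assms(1) bounded_linear_inner_left]
          smooth_on_frechet_derivative assms)
    have "frechet_derivative (\<lambda>y. frechet_derivative (\<lambda>y. f y \<bullet> w) (at y) a) (at x)
        = frechet_derivative (\<lambda>y. frechet_derivative f (at y) a \<bullet> w) (at x)"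
      by (rule frechet_derivative_transform_within_open[symmetric,
            OF smooth_on_differentiable[OF s assms(3)] assms(1,3)])
         (simp add: ip[OF assms(2)])
    then show ?thesis
      by (simp add: ip[OF smooth_on_frechet_derivative[OF assms(2)] assms(3)])
  qed
  have "frechet_derivative (\<lambda>y. frechet_derivative f (at y) u) (at x) v \<bullet> w
       = frechet_derivative (\<lambda>y. frechet_derivative f (at y) v) (at x) u \<bullet> w" for w
    using second_derivative_symmetric_real[OF assms(1) smooth_on_linear[OF assms(1) bounded_linear_inner_left assms(2)]
        assms(3), of w u v] by (simp add: two)
  then show ?thesis by (metis inner_commute vector_eq_rdot)
qed


section \<open>Alternating multilinear maps and the local Cartan formula\<close>

definition alternating_map :: "('a::real_vector list \<Rightarrow> 'b::real_vector) \<Rightarrow> bool" where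
  "alternating_map \<alpha> \<longleftrightarrow>
     (\<forall>us v w vs a b. \<alpha> (us @ (a *\<^sub>R v + b *\<^sub>R w) # vs) = a *\<^sub>R \<alpha> (us @ v # vs) + b *\<^sub>R \<alpha> (us @ w # vs)) \<and>
     (\<forall>vs i j. i < j \<and> j < length vs \<and> vs ! i = vs ! j \<longrightarrow> \<alpha> vs = 0)"

lemma alternating_map_linear:
  assumes "alternating_map \<alpha>"
  shows "linear (\<lambda>v. \<alpha> (us @ v # vs))"
proof (rule linearI)
  have *: "\<alpha> (us @ (a *\<^sub>R v + b *\<^sub>R w) # vs) = a *\<^sub>R \<alpha> (us @ v # vs) + b *\<^sub>R \<alpha> (us @ w # vs)" for a b v w
    using assms unfolding alternating_map_def by blast
  show "\<alpha> (us @ (v + w) # vs) = \<alpha> (us @ v # vs) + \<alpha> (us @ w # vs)" for v w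
    using *[of 1 v 1 w] by simp
  show "\<alpha> (us @ (c *\<^sub>R v) # vs) = c *\<^sub>R \<alpha> (us @ v # vs)" for c v
    using *[of c v 0 v] by simp
qed

lemmas alternating_map_linear_hd = alternating_map_linear[where us = "[]", simplified]

lemma alternating_map_repeat:
  "alternating_map \<alpha> \<Longrightarrow> i < j \<Longrightarrow> j < length vs \<Longrightarrow> vs ! i = vs ! j \<Longrightarrow> \<alpha> vs = 0"
  unfolding alternating_map_def by blast

lemma alternating_map_swap:
  assumes "alternating_map \<alpha>"
  shows "\<alpha> (v # w # vs) + \<alpha> (w # v # vs) = 0"
proof -
  have z: "\<alpha> (u # u # vs) = 0" for u
    by (rule alternating_map_repeat[OF assms, of 0 1]) auto
  have "\<alpha> ((v + w) # (v + w) # vs)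
      = \<alpha> (v # v # vs) + \<alpha> (v # w # vs) + (\<alpha> (w # v # vs) + \<alpha> (w # w # vs))"
    using linear_add[OF alternating_map_linear[OF assms, of "[v]"]]
      linear_add[OF alternating_map_linear[OF assms, of "[w]"]]
      linear_add[OF alternating_map_linear_hd[OF assms]] by simp
  then show ?thesis by (simp add: z)
qed

text \<open>Expanding every argument in the frame leaves only values on lists of frame vectors, and a long
  list of these has a repetition. The accumulator \<open>us\<close> holds the arguments already expanded.\<close>

lemma alternating_map_vanishes:
  assumes "parseval_frame (B::'a::real_inner set)" "alternating_map \<alpha>"
  shows "set us \<subseteq> B \<Longrightarrow> card B < length us + length vs \<Longrightarrow> \<alpha> (us @ vs) = 0"
proof (induction vs arbitrary: us)
  case Nil
  have fin: "finite B" using assms(1) by (simp add: parseval_frame_def)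
  have "\<not> distinct us"
    using Nil card_mono[OF fin Nil(1)] distinct_card[of us] by auto
  then obtain i j where "i < j" "j < length us" "us ! i = us ! j"
    unfolding distinct_conv_nth by (metis linorder_neqE_nat)
  then show ?case using alternating_map_repeat[OF assms(2)] by simp
next
  case (Cons v vs)
  have v: "v = (\<Sum>b\<in>B. (v \<bullet> b) *\<^sub>R b)"
    using assms(1) by (simp add: parseval_frame_def)
  have "\<alpha> (us @ b # vs) = 0" if "b \<in> B" for b
    using Cons.IH[of "us @ [b]"] Cons.prems that by simp
  then have "\<alpha> (us @ (\<Sum>b\<in>B. (v \<bullet> b) *\<^sub>R b) # vs) = 0"
    by (simp add: linear_sum[OF alternating_map_linear[OF assms(2)]]
        linear_scale[OF alternating_map_linear[OF assms(2)]])
  then show ?case using v by simp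
qed

lemma drop_nth_0_Cons [simp]: "drop_nth 0 (v # vs) = vs"
  and drop_nth_Suc_Cons [simp]: "drop_nth (Suc i) (v # vs) = v # drop_nth i vs"
  by (simp_all add: drop_nth_def)

lemma map_drop_nth: "map f (drop_nth i vs) = drop_nth i (map f vs)"
  by (simp add: drop_nth_def take_map drop_map)

lemma length_drop_nth: "i < length vs \<Longrightarrow> length (drop_nth i vs) = length vs - 1"
  by (simp add: drop_nth_def)

lemma set_drop_nth: "i < length vs \<Longrightarrow> insert (vs ! i) (set (drop_nth i vs)) = set vs"
  by (metis (no_types) drop_nth_def id_take_nth_drop list.simps(15) Un_insert_right set_append)

text \<open>The product rule for a linear map applied to a vector, both depending on \<open>y\<close>. The linear maps are only
  known to be differentiable when evaluated at fixed vectors; expanding \<open>Y\<close> in the frame reduces the claim to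
  finitely many products of scalars with such evaluations.\<close>

lemma linear_family_has_derivative:
  fixes g :: "'a::real_inner \<Rightarrow> 'a \<Rightarrow> 'b::real_normed_vector"
  assumes B: "parseval_frame (B::'a set)" and "open S" "x \<in> S"
    and lin: "\<And>y. y \<in> S \<Longrightarrow> linear (g y)"
    and g: "\<And>b. (\<lambda>y. g y b) differentiable (at x)" and Y: "Y differentiable (at x)"
  shows "((\<lambda>y. g y (Y y)) has_derivative
    (\<lambda>v. frechet_derivative (\<lambda>y. g y (Y x)) (at x) v + g x (frechet_derivative Y (at x) v))) (at x)"
proof -
  note ex = B[unfolded parseval_frame_def, THEN conjunct2, rule_format]
  have expand: "g y u = (\<Sum>b\<in>B. (u \<bullet> b) *\<^sub>R g y b)" if "y \<in> S" for y u
    using linear_sum[OF lin[OF that], of "\<lambda>b. (u \<bullet> b) *\<^sub>R b" B]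
    by (simp add: ex linear_scale[OF lin[OF that]])
  let ?dg = "\<lambda>b. frechet_derivative (\<lambda>y. g y b) (at x)" and ?dY = "frechet_derivative Y (at x)"
  have "((\<lambda>y. \<Sum>b\<in>B. (Y x \<bullet> b) *\<^sub>R g y b) has_derivative (\<lambda>v. \<Sum>b\<in>B. (Y x \<bullet> b) *\<^sub>R ?dg b v)) (at x)"
    by (intro has_derivative_sum has_derivative_scaleR_right has_frechet_derivative g)
  then have dgY0: "((\<lambda>y. g y (Y x)) has_derivative (\<lambda>v. \<Sum>b\<in>B. (Y x \<bullet> b) *\<^sub>R ?dg b v)) (at x)"
    by (rule has_derivative_transform_within_open[OF _ assms(2,3)]) (simp add: expand[symmetric])
  have dgY: "frechet_derivative (\<lambda>y. g y (Y x)) (at x) v = (\<Sum>b\<in>B. (Y x \<bullet> b) *\<^sub>R ?dg b v)" for v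
    by (rule frechet_derivative_apply[OF dgY0])
  have "((\<lambda>y. \<Sum>b\<in>B. (Y y \<bullet> b) *\<^sub>R g y b) has_derivative
      (\<lambda>v. \<Sum>b\<in>B. (Y x \<bullet> b) *\<^sub>R ?dg b v + (?dY v \<bullet> b) *\<^sub>R g x b)) (at x)"
    by (intro has_derivative_sum has_derivative_scaleR has_derivative_inner_left
        has_frechet_derivative g Y)
  then have "((\<lambda>y. \<Sum>b\<in>B. (Y y \<bullet> b) *\<^sub>R g y b) has_derivative
      (\<lambda>v. frechet_derivative (\<lambda>y. g y (Y x)) (at x) v + g x (?dY v))) (at x)"
    by (simp add: dgY expand[OF assms(3), of "?dY _"] sum.distrib)
  then show ?thesis
    by (rule has_derivative_transform_within_open[OF _ assms(2,3)]) (simp add: expand[symmetric])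
qed

text \<open>For a section \<open>s\<close> with value \<open>e\<close> at the point and covariant derivative \<open>\<theta>\<close> there,
  \<open>twisted_deriv e \<theta> x f v\<close> is \<open>\<nabla>\<^sub>v (f s)\<close>, and \<open>twisted_ext_deriv\<close> is \<open>\<nabla> (\<tau> \<otimes> s)\<close> for a form \<open>\<tau>\<close>
  with components \<open>W\<close> in a chart.\<close>

definition twisted_deriv ::
    "'w::real_vector \<Rightarrow> ('a::real_normed_vector \<Rightarrow> 'w) \<Rightarrow> 'a \<Rightarrow> ('a \<Rightarrow> real) \<Rightarrow> 'a \<Rightarrow> 'w" where
  "twisted_deriv e \<theta> x f v = frechet_derivative f (at x) v *\<^sub>R e + f x *\<^sub>R \<theta> v"

definition twisted_ext_deriv ::
    "'w::real_vector \<Rightarrow> ('a::real_normed_vector \<Rightarrow> 'w) \<Rightarrow> 'a \<Rightarrow> ('a \<Rightarrow> 'a list \<Rightarrow> real) \<Rightarrow> 'a list \<Rightarrow> 'w" where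
  "twisted_ext_deriv e \<theta> x W es =
     (\<Sum>i<length es. (-1) ^ i *\<^sub>R twisted_deriv e \<theta> x (\<lambda>y. W y (drop_nth i es)) (es ! i))"

lemma twisted_ext_deriv_Cons:
  "twisted_ext_deriv e \<theta> x W (a # es) = twisted_deriv e \<theta> x (\<lambda>y. W y es) a -
     twisted_ext_deriv e \<theta> x (\<lambda>y vs. W y (a # vs)) es"
  by (simp add: twisted_ext_deriv_def sum.lessThan_Suc_shift sum_negf del: sum.lessThan_Suc)

text \<open>All derivatives of \<open>W\<close> cancel, because they occur with the values of \<open>X\<close> and \<open>Y\<close> at \<open>x\<close>
  only; the derivatives of \<open>X\<close> and \<open>Y\<close> in the directions \<open>es\<close> cancel by antisymmetry. The
  derivatives of \<open>X\<close> and \<open>Y\<close> along each other remain, and form the bracket.\<close>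

lemma cartan_formula_local:
  fixes W :: "'a::real_inner \<Rightarrow> 'a list \<Rightarrow> real"
  assumes B: "parseval_frame (B::'a set)" and S: "open S" "x \<in> S"
    and alt: "\<And>y. y \<in> S \<Longrightarrow> alternating_map (W y)"
    and W: "\<And>es. (\<lambda>y. W y es) differentiable (at x)"
    and X: "X differentiable (at x)" and Y: "Y differentiable (at x)"
  shows "W x ((frechet_derivative Y (at x) (X x) - frechet_derivative X (at x) (Y x)) # es) *\<^sub>R e =
      twisted_ext_deriv e \<theta> x (\<lambda>y vs. W y (Y y # vs)) (X x # es)
    + twisted_ext_deriv e \<theta> x (\<lambda>y vs. W y (Y y # X y # vs)) es
    - twisted_ext_deriv e \<theta> x W (X x # Y x # es)
    - twisted_ext_deriv e \<theta> x (\<lambda>y vs. W y (X y # vs)) (Y x # es)"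
proof -
  let ?D = "\<lambda>f. frechet_derivative f (at x)" and ?T = "twisted_deriv e \<theta> x"
  have one: "((\<lambda>y. W y (Z y # vs)) has_derivative (\<lambda>v. ?D (\<lambda>y. W y (Z x # vs)) v + W x (?D Z v # vs))) (at x)"
    if "Z differentiable (at x)" for Z vs
    by (rule linear_family_has_derivative[OF B S alternating_map_linear_hd[OF alt] W that])
  have D1: "?D (\<lambda>y. W y (Z y # vs)) v = ?D (\<lambda>y. W y (Z x # vs)) v + W x (?D Z v # vs)"
    if "Z differentiable (at x)" for Z vs v
    by (rule frechet_derivative_apply[OF one[OF that]])
  have two: "((\<lambda>y. W y (Y y # X y # vs)) has_derivative
      (\<lambda>v. ?D (\<lambda>y. W y (Y y # X x # vs)) v + W x (Y x # ?D X v # vs))) (at x)" for vs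
  proof (rule linear_family_has_derivative[OF B S, of "\<lambda>y u. W y (Y y # u # vs)" X])
    show "linear (\<lambda>u. W y (Y y # u # vs))" if "y \<in> S" for y
      using alternating_map_linear[OF alt[OF that], of "[Y y]"] by simp
    show "(\<lambda>y. W y (Y y # b # vs)) differentiable (at x)" for b
      by (rule Derivative.differentiableI[OF one[OF Y]])
  qed (rule X)
  have D2: "?D (\<lambda>y. W y (Y y # X y # vs)) v =
      ?D (\<lambda>y. W y (Y y # X x # vs)) v + W x (Y x # ?D X v # vs)" for vs v
    by (rule frechet_derivative_apply[OF two])
  have T1: "?T (\<lambda>y. W y (Z y # vs)) v = ?T (\<lambda>y. W y (Z x # vs)) v + W x (?D Z v # vs) *\<^sub>R e"
    if "Z differentiable (at x)" for Z vs v
    by (simp add: twisted_deriv_def D1[OF that] scaleR_add_left)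
  have sw: "W x (u # w # vs) = - W x (w # u # vs)" for u w vs
    using alternating_map_swap[OF alt[OF S(2)], of u w vs] by simp
  have tail: "?T (\<lambda>y. W y (Y y # X y # vs)) v - ?T (\<lambda>y. W y (Y y # X x # vs)) v
      - ?T (\<lambda>y. W y (X x # Y x # vs)) v + ?T (\<lambda>y. W y (X y # Y x # vs)) v = 0" for vs v
    by (simp add: twisted_deriv_def D2 D1[OF Y] D1[OF X] sw[of "Y x" "?D X v" vs]
        scaleR_add_left scaleR_diff_left)
  have "twisted_ext_deriv e \<theta> x (\<lambda>y vs. W y (Y y # X y # vs)) es
      - twisted_ext_deriv e \<theta> x (\<lambda>y vs. W y (Y y # X x # vs)) es
      - twisted_ext_deriv e \<theta> x (\<lambda>y vs. W y (X x # Y x # vs)) es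
      + twisted_ext_deriv e \<theta> x (\<lambda>y vs. W y (X y # Y x # vs)) es = 0"
    unfolding twisted_ext_deriv_def sum_subtractf[symmetric] sum.distrib[symmetric]
      scaleR_diff_right[symmetric] scaleR_add_right[symmetric] tail by simp
  moreover have "W x ((?D Y (X x) - ?D X (Y x)) # es) *\<^sub>R e =
      W x (?D Y (X x) # es) *\<^sub>R e - W x (?D X (Y x) # es) *\<^sub>R e"
    by (simp add: linear_diff[OF alternating_map_linear_hd[OF alt[OF S(2)]]] scaleR_diff_left)
  ultimately show ?thesis
    by (simp add: twisted_ext_deriv_Cons T1[OF X] T1[OF Y] add_eq_0_iff algebra_simps)
qed


section \<open>Charts and tangent vectors\<close>

lemma alternating_onD:
  assumes "alternating_on TM F \<alpha>"
  shows "\<alpha> vs \<in> F" and "\<not> set vs \<subseteq> TM \<Longrightarrow> \<alpha> vs = 0"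
    and "\<lbrakk>set us \<subseteq> TM; v \<in> TM; w \<in> TM; set vs \<subseteq> TM\<rbrakk> \<Longrightarrow>
      \<alpha> (us @ (\<lambda>\<kappa>. a *\<^sub>R v \<kappa> + b *\<^sub>R w \<kappa>) # vs) = a *\<^sub>R \<alpha> (us @ v # vs) + b *\<^sub>R \<alpha> (us @ w # vs)"
    and "\<lbrakk>set vs \<subseteq> TM; i < j; j < length vs; vs ! i = vs ! j\<rbrakk> \<Longrightarrow> \<alpha> vs = 0"
  using assms unfolding alternating_on_def by simp_all blast

locale manifold =
  fixes A :: "('m::{t2_space,second_countable_topology}, 'e::real_inner) chart set"
  assumes atlas: "smooth_atlas A"
begin

lemma frame_exists:
  obtains B where "parseval_frame (B::'e set)"
  using atlas parseval_frame_exists unfolding smooth_atlas_def by blast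

lemma chart_around:
  obtains \<kappa> where "\<kappa> \<in> A" "p \<in> fst \<kappa>"
  using atlas unfolding smooth_atlas_def by blast

lemma chart_at: "chart_at A p \<in> A" "p \<in> fst (chart_at A p)"
  using someI_ex[of "\<lambda>\<kappa>. \<kappa> \<in> A \<and> p \<in> fst \<kappa>"] chart_around[of p]
  unfolding chart_at_def by blast+

lemma chart_homeomorphism:
  "\<kappa> \<in> A \<Longrightarrow> homeomorphism (fst \<kappa>) (snd \<kappa> ` fst \<kappa>) (snd \<kappa>) (chart_inv \<kappa>)"
  using atlas unfolding smooth_atlas_def by blast

lemma open_chart_domain: "\<kappa> \<in> A \<Longrightarrow> open (fst \<kappa>)"
  using atlas unfolding smooth_atlas_def by blast

lemma open_chart_image:
  assumes "\<kappa> \<in> A" "open Q"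
  shows "open (snd \<kappa> ` (fst \<kappa> \<inter> Q))"
proof -
  have "openin (top_of_set (snd \<kappa> ` fst \<kappa>)) (snd \<kappa> ` (fst \<kappa> \<inter> Q))"
    by (rule homeomorphism_imp_open_map[OF chart_homeomorphism[OF assms(1)]])
       (rule openin_open_Int[OF assms(2)])
  moreover have "open (snd \<kappa> ` fst \<kappa>)"
    using atlas assms(1) unfolding smooth_atlas_def by blast
  ultimately show ?thesis using openin_open_trans by blast
qed

lemma chart_inv_chart [simp]: "\<kappa> \<in> A \<Longrightarrow> q \<in> fst \<kappa> \<Longrightarrow> chart_inv \<kappa> (snd \<kappa> q) = q"
  using chart_homeomorphism homeomorphism_apply1 by blast

lemma chart_image_iff:
  "\<kappa> \<in> A \<Longrightarrow> x \<in> snd \<kappa> ` (fst \<kappa> \<inter> Q) \<longleftrightarrow>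
    chart_inv \<kappa> x \<in> fst \<kappa> \<and> chart_inv \<kappa> x \<in> Q \<and> snd \<kappa> (chart_inv \<kappa> x) = x"
  by (auto intro!: image_eqI[of x "snd \<kappa>" "chart_inv \<kappa> x"])

lemma smooth_transition:
  "\<kappa> \<in> A \<Longrightarrow> \<mu> \<in> A \<Longrightarrow> smooth_on (snd \<kappa> ` (fst \<kappa> \<inter> fst \<mu>)) (snd \<mu> \<circ> chart_inv \<kappa>)"
  using atlas unfolding smooth_atlas_def by blast

lemma transition_has_derivative:
  assumes "\<kappa> \<in> A" "\<mu> \<in> A" "q \<in> fst \<kappa>" "q \<in> fst \<mu>"
  shows "((snd \<mu> \<circ> chart_inv \<kappa>) has_derivative
    frechet_derivative (snd \<mu> \<circ> chart_inv \<kappa>) (at (snd \<kappa> q))) (at (snd \<kappa> q))"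
  by (rule smooth_on_has_derivative[OF smooth_transition[OF assms(1,2)]]) (use assms in auto)

lemma transition_derivative_compose:
  assumes "\<kappa> \<in> A" "\<mu> \<in> A" "\<nu> \<in> A" "q \<in> fst \<kappa>" "q \<in> fst \<mu>" "q \<in> fst \<nu>"
  shows "frechet_derivative (snd \<nu> \<circ> chart_inv \<kappa>) (at (snd \<kappa> q)) e =
    frechet_derivative (snd \<nu> \<circ> chart_inv \<mu>) (at (snd \<mu> q))
      (frechet_derivative (snd \<mu> \<circ> chart_inv \<kappa>) (at (snd \<kappa> q)) e)"
proof -
  let ?d = "frechet_derivative (snd \<nu> \<circ> chart_inv \<mu>) (at (snd \<mu> q)) \<circ>
      frechet_derivative (snd \<mu> \<circ> chart_inv \<kappa>) (at (snd \<kappa> q))"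
  have q: "(snd \<mu> \<circ> chart_inv \<kappa>) (snd \<kappa> q) = snd \<mu> q" using assms by simp
  have "((snd \<nu> \<circ> chart_inv \<mu>) \<circ> (snd \<mu> \<circ> chart_inv \<kappa>) has_derivative ?d) (at (snd \<kappa> q))"
    by (rule diff_chain_at) (use transition_has_derivative[of \<kappa> \<mu> q]
        transition_has_derivative[of \<mu> \<nu> q] assms q in auto)
  then have "((snd \<nu> \<circ> chart_inv \<kappa>) has_derivative ?d) (at (snd \<kappa> q))"
    by (rule has_derivative_transform_within_open
        [OF _ open_chart_image[OF assms(1) open_chart_domain[OF assms(2)]]])
       (use assms in auto)
  from frechet_derivative_apply[OF this] show ?thesis by simp
qed

lemma transition_derivative_self:
  assumes "\<kappa> \<in> A" "q \<in> fst \<kappa>"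
  shows "frechet_derivative (snd \<kappa> \<circ> chart_inv \<kappa>) (at (snd \<kappa> q)) e = e"
proof -
  have "((\<lambda>x. x) has_derivative (\<lambda>e. e)) (at (snd \<kappa> q))" by (rule has_derivative_ident)
  then have "((snd \<kappa> \<circ> chart_inv \<kappa>) has_derivative (\<lambda>e. e)) (at (snd \<kappa> q))"
    by (rule has_derivative_transform_within_open[OF _ open_chart_image[OF assms(1) open_UNIV]])
       (use assms in auto)
  then show ?thesis by (rule frechet_derivative_apply)
qed

lemma coord_vec_tangent:
  assumes "\<kappa> \<in> A" "q \<in> fst \<kappa>"
  shows "coord_vec A \<kappa> q e \<in> tangent_space A q"
proof -
  have "coord_vec A \<kappa> q e \<nu> =
      frechet_derivative (snd \<nu> \<circ> chart_inv \<mu>) (at (snd \<mu> q)) (coord_vec A \<kappa> q e \<mu>)"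
    if "\<mu> \<in> A" "\<nu> \<in> A" "q \<in> fst \<mu> \<inter> fst \<nu>" for \<mu> \<nu>
    using transition_derivative_compose[of \<kappa> \<mu> \<nu> q e] assms that by (simp add: coord_vec_def)
  moreover have "coord_vec A \<kappa> q e \<mu> = 0" if "\<not> (\<mu> \<in> A \<and> q \<in> fst \<mu>)" for \<mu>
    using that by (auto simp: coord_vec_def)
  ultimately show ?thesis unfolding tangent_space_def by blast
qed

lemma coord_vec_same: "\<kappa> \<in> A \<Longrightarrow> q \<in> fst \<kappa> \<Longrightarrow> coord_vec A \<kappa> q e \<kappa> = e"
  by (simp add: coord_vec_def transition_derivative_self)

lemma coord_vec_of_tangent:
  assumes "\<kappa> \<in> A" "q \<in> fst \<kappa>" "v \<in> tangent_space A q"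
  shows "coord_vec A \<kappa> q (v \<kappa>) = v"
proof
  fix \<mu>
  have "\<not> (\<mu> \<in> A \<and> q \<in> fst \<mu>) \<Longrightarrow> v \<mu> = 0"
    and "\<mu> \<in> A \<and> q \<in> fst \<mu> \<Longrightarrow>
      v \<mu> = frechet_derivative (snd \<mu> \<circ> chart_inv \<kappa>) (at (snd \<kappa> q)) (v \<kappa>)"
    using assms unfolding tangent_space_def by blast+
  then show "coord_vec A \<kappa> q (v \<kappa>) \<mu> = v \<mu>"
    unfolding coord_vec_def by presburger
qed

lemma map_coord_vec_of_tangent:
  assumes "\<kappa> \<in> A" "q \<in> fst \<kappa>" "set vs \<subseteq> tangent_space A q"
  shows "map (coord_vec A \<kappa> q) (map (\<lambda>v. v \<kappa>) vs) = vs"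
  using assms(3) coord_vec_of_tangent[OF assms(1,2)] by (induction vs) auto

lemma coord_vec_linear:
  assumes "\<kappa> \<in> A" "q \<in> fst \<kappa>"
  shows "coord_vec A \<kappa> q (a *\<^sub>R d + b *\<^sub>R e) =
    (\<lambda>\<mu>. a *\<^sub>R coord_vec A \<kappa> q d \<mu> + b *\<^sub>R coord_vec A \<kappa> q e \<mu>)"
proof
  fix \<mu>
  show "coord_vec A \<kappa> q (a *\<^sub>R d + b *\<^sub>R e) \<mu> =
    a *\<^sub>R coord_vec A \<kappa> q d \<mu> + b *\<^sub>R coord_vec A \<kappa> q e \<mu>"
  proof (cases "\<mu> \<in> A \<and> q \<in> fst \<mu>")
    case True
    then have l: "linear (frechet_derivative (snd \<mu> \<circ> chart_inv \<kappa>) (at (snd \<kappa> q)))"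
      using has_derivative_linear[OF transition_has_derivative[OF assms(1) _ assms(2)]] by blast
    show ?thesis using True by (simp add: coord_vec_def linear_add[OF l] linear_scale[OF l])
  qed (auto simp: coord_vec_def)
qed

text \<open>Reading arguments as coordinate vectors turns a form at \<open>q\<close> into an alternating map on the model space,
  which no longer mentions tangent spaces.\<close>

lemma alternating_map_of_alternating_on:
  assumes "alternating_on (tangent_space A q) F \<alpha>" "\<kappa> \<in> A" "q \<in> fst \<kappa>"
  shows "alternating_map (\<lambda>es. \<alpha> (map (coord_vec A \<kappa> q) es))"
proof -
  have tan: "set (map (coord_vec A \<kappa> q) es) \<subseteq> tangent_space A q" for es
    using coord_vec_tangent[OF assms(2,3)] by auto
  have "\<alpha> (map (coord_vec A \<kappa> q) us @ coord_vec A \<kappa> q (a *\<^sub>R v + b *\<^sub>R w) # map (coord_vec A \<kappa> q) vs)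
      = a *\<^sub>R \<alpha> (map (coord_vec A \<kappa> q) us @ coord_vec A \<kappa> q v # map (coord_vec A \<kappa> q) vs)
      + b *\<^sub>R \<alpha> (map (coord_vec A \<kappa> q) us @ coord_vec A \<kappa> q w # map (coord_vec A \<kappa> q) vs)"
    for us v w vs a b
    unfolding coord_vec_linear[OF assms(2,3)]
    by (intro alternating_onD(3)[OF assms(1)] tan coord_vec_tangent[OF assms(2,3)])
  moreover have "\<alpha> (map (coord_vec A \<kappa> q) vs) = 0"
    if "i < j" "j < length vs" "vs ! i = vs ! j" for vs i j
    by (rule alternating_onD(4)[OF assms(1) tan, of i j]) (use that in auto)
  ultimately show ?thesis unfolding alternating_map_def by (simp, blast)
qed

lemma vector_field_coord_vec:
  "smooth_vector_field A X \<Longrightarrow> \<kappa> \<in> A \<Longrightarrow> q \<in> fst \<kappa> \<Longrightarrow> coord_vec A \<kappa> q (X q \<kappa>) = X q"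
  using coord_vec_of_tangent unfolding smooth_vector_field_def by blast

lemma vector_field_smooth:
  "smooth_vector_field A X \<Longrightarrow> \<kappa> \<in> A \<Longrightarrow> smooth_on (snd \<kappa> ` fst \<kappa>) (\<lambda>x. X (chart_inv \<kappa> x) \<kappa>)"
  unfolding smooth_vector_field_def by blast

text \<open>Under a change of charts \<open>\<tau>\<close>, each of the two terms of the bracket picks up a second
  derivative of \<open>\<tau>\<close>, and the bracket is a tangent vector because that derivative is symmetric.\<close>

lemma lie_bracket_tangent:
  assumes X: "smooth_vector_field A X" and Y: "smooth_vector_field A Y"
  shows "lie_bracket A X Y p \<in> tangent_space A p"
proof -
  have "lie_bracket A X Y p \<mu> = frechet_derivative (snd \<mu> \<circ> chart_inv \<kappa>) (at (snd \<kappa> p)) (lie_bracket A X Y p \<kappa>)"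
    if \<kappa>: "\<kappa> \<in> A" "p \<in> fst \<kappa>" and \<mu>: "\<mu> \<in> A" "p \<in> fst \<mu>" for \<kappa> \<mu>
  proof -
    obtain B where B: "parseval_frame (B::'e set)" by (rule frame_exists)
    let ?S = "snd \<kappa> ` (fst \<kappa> \<inter> fst \<mu>)" and ?\<tau> = "snd \<mu> \<circ> chart_inv \<kappa>" and ?x = "snd \<kappa> p"
    let ?D = "\<lambda>f. frechet_derivative f (at ?x)"
    have S: "open ?S" "?x \<in> ?S" using open_chart_image open_chart_domain \<kappa> \<mu> by auto
    have \<tau>: "smooth_on ?S ?\<tau>" by (rule smooth_transition[OF \<kappa>(1) \<mu>(1)])
    have d\<tau>: "(?\<tau> has_derivative ?D ?\<tau>) (at ?x)" by (rule smooth_on_has_derivative[OF \<tau> S(2)])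
    have \<tau>x: "?\<tau> ?x = snd \<mu> p" using \<kappa> by simp
    have Zd: "(\<lambda>x. Z (chart_inv \<nu> x) \<nu>) differentiable (at (snd \<nu> p))"
      if "smooth_vector_field A Z" "\<nu> \<in> A" "p \<in> fst \<nu>" for Z \<nu>
      by (rule smooth_on_differentiable[OF vector_field_smooth[OF that(1,2)]]) (use that in auto)
    have trafo: "Z (chart_inv \<mu> (?\<tau> y)) \<mu> = frechet_derivative ?\<tau> (at y) (Z (chart_inv \<kappa> y) \<kappa>)"
      if "smooth_vector_field A Z" "y \<in> ?S" for Z y
    proof -
      have y: "chart_inv \<kappa> y \<in> fst \<kappa> \<inter> fst \<mu>" "snd \<kappa> (chart_inv \<kappa> y) = y"
        using that(2) chart_image_iff[OF \<kappa>(1)] by auto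
      have "Z (chart_inv \<kappa> y) \<in> tangent_space A (chart_inv \<kappa> y)"
        using that(1) unfolding smooth_vector_field_def by blast
      then have "Z (chart_inv \<kappa> y) \<mu> =
          frechet_derivative ?\<tau> (at (snd \<kappa> (chart_inv \<kappa> y))) (Z (chart_inv \<kappa> y) \<kappa>)"
        unfolding tangent_space_def using \<kappa>(1) \<mu>(1) y(1) by blast
      then show ?thesis using y \<mu>(1) by simp
    qed
    have key: "frechet_derivative (\<lambda>x. Z (chart_inv \<mu> x) \<mu>) (at (snd \<mu> p)) (?D ?\<tau> v) =
        ?D (\<lambda>y. frechet_derivative ?\<tau> (at y) (Z p \<kappa>)) v + ?D ?\<tau> (?D (\<lambda>x. Z (chart_inv \<kappa> x) \<kappa>) v)"
      if Z: "smooth_vector_field A Z" for Z v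
    proof -
      let ?Z\<mu> = "\<lambda>x. Z (chart_inv \<mu> x) \<mu>" and ?Z\<kappa> = "\<lambda>x. Z (chart_inv \<kappa> x) \<kappa>"
      have "((\<lambda>y. frechet_derivative ?\<tau> (at y) (?Z\<kappa> y)) has_derivative
          (\<lambda>v. ?D (\<lambda>y. frechet_derivative ?\<tau> (at y) (?Z\<kappa> ?x)) v + ?D ?\<tau> (?D ?Z\<kappa> v))) (at ?x)"
        by (rule linear_family_has_derivative[OF B S has_derivative_linear[OF smooth_on_has_derivative[OF \<tau>]]
              smooth_on_differentiable[OF smooth_on_frechet_derivative[OF \<tau>] S(2)] Zd[OF Z \<kappa>]])
      then have "((\<lambda>y. ?Z\<mu> (?\<tau> y)) has_derivative
          (\<lambda>v. ?D (\<lambda>y. frechet_derivative ?\<tau> (at y) (?Z\<kappa> ?x)) v + ?D ?\<tau> (?D ?Z\<kappa> v))) (at ?x)"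
        by (rule has_derivative_transform_within_open[OF _ S]) (simp only: trafo[OF Z])
      moreover have "((\<lambda>y. ?Z\<mu> (?\<tau> y)) has_derivative
          (\<lambda>v. frechet_derivative ?Z\<mu> (at (snd \<mu> p)) (?D ?\<tau> v))) (at ?x)"
        using diff_chain_at[OF d\<tau>, of ?Z\<mu>] has_frechet_derivative[OF Zd[OF Z \<mu>]]
        unfolding \<tau>x by (simp add: o_def)
      ultimately have eq: "(\<lambda>v. frechet_derivative ?Z\<mu> (at (snd \<mu> p)) (?D ?\<tau> v)) =
          (\<lambda>v. ?D (\<lambda>y. frechet_derivative ?\<tau> (at y) (?Z\<kappa> ?x)) v + ?D ?\<tau> (?D ?Z\<kappa> v))"
        by (rule has_derivative_unique[rotated])
      have "chart_inv \<kappa> ?x = p" using \<kappa> by simp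
      with fun_cong[OF eq, of v] show ?thesis by (simp only:)
    qed
    have val: "Z p \<mu> = ?D ?\<tau> (Z p \<kappa>)" if "smooth_vector_field A Z" for Z
      using trafo[OF that S(2)] \<kappa> \<mu> by simp
    have "?D (\<lambda>y. frechet_derivative ?\<tau> (at y) (Y p \<kappa>)) (X p \<kappa>)
        = ?D (\<lambda>y. frechet_derivative ?\<tau> (at y) (X p \<kappa>)) (Y p \<kappa>)"
      by (rule second_derivative_symmetric[OF S(1) \<tau> S(2)])
    then show ?thesis
      using \<kappa> \<mu> linear_diff[OF has_derivative_linear[OF d\<tau>]]
      by (simp add: lie_bracket_def val[OF X] val[OF Y] key[OF X] key[OF Y])
  qed
  moreover have "lie_bracket A X Y p \<mu> = 0" if "\<not> (\<mu> \<in> A \<and> p \<in> fst \<mu>)" for \<mu>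
    using that by (auto simp: lie_bracket_def)
  ultimately show ?thesis unfolding tangent_space_def by blast
qed


section \<open>Bump functions\<close>

text \<open>In a chart around \<open>p\<close>, the cutoff is applied to the squared distance from \<open>p\<close>. Its support is the preimage of a
  ball, hence compact, hence closed in the Hausdorff space \<open>M\<close>; so extension by zero is smooth.\<close>

lemma bump_function:
  assumes "open Q" "p \<in> Q"
  obtains \<beta> :: "'m \<Rightarrow> real" and K N where "smooth_map_on A UNIV \<beta>" "closed K" "K \<subseteq> Q"
    "\<And>q. q \<notin> K \<Longrightarrow> \<beta> q = 0" "open N" "p \<in> N" "\<And>q. q \<in> N \<Longrightarrow> \<beta> q = 1"
proof -
  obtain B where B: "parseval_frame (B::'e set)" by (rule frame_exists)
  obtain \<kappa> where \<kappa>: "\<kappa> \<in> A" "p \<in> fst \<kappa>" by (rule chart_around)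
  obtain h :: "real \<Rightarrow> real" where h: "smooth_on UNIV h"
    "\<And>t. t \<le> 0 \<Longrightarrow> h t = 1" "\<And>t. t \<ge> 1 \<Longrightarrow> h t = 0" by (rule smooth_cutoff_exists) blast
  define c where "c = snd \<kappa> p"
  have "c \<in> snd \<kappa> ` (fst \<kappa> \<inter> Q)" using \<kappa> assms(2) by (auto simp: c_def)
  then obtain \<delta> where \<delta>: "\<delta> > 0" "cball c \<delta> \<subseteq> snd \<kappa> ` (fst \<kappa> \<inter> Q)"
    using open_chart_image[OF \<kappa>(1) assms(1)] open_contains_cball by blast
  define \<epsilon> where "\<epsilon> = \<delta> / 2"
  have \<epsilon>: "\<epsilon> > 0" "cball c (2 * \<epsilon>) \<subseteq> snd \<kappa> ` (fst \<kappa> \<inter> Q)" using \<delta> by (auto simp: \<epsilon>_def)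
  (* rescaled so that \<rho> is 0 on the sphere of radius \<epsilon> and 1 on the sphere of radius 2 \<epsilon> *)
  define \<rho> where "\<rho> z = ((z + - c) \<bullet> (z + - c) + - \<epsilon>\<^sup>2) * (1 / (3 * \<epsilon>\<^sup>2))" for z
  define \<beta> where "\<beta> q = (if q \<in> fst \<kappa> then h (\<rho> (snd \<kappa> q)) else 0)" for q
  define K where "K = chart_inv \<kappa> ` cball c (2 * \<epsilon>)"
  define N where "N = fst \<kappa> \<inter> snd \<kappa> -` ball c \<epsilon>"
  have sq: "(z + - c) \<bullet> (z + - c) = (dist c z)\<^sup>2" for z
    unfolding power2_norm_eq_inner[symmetric] by (simp add: dist_norm norm_minus_commute)
  have \<rho>: "\<rho> z = ((dist c z)\<^sup>2 + - \<epsilon>\<^sup>2) * (1 / (3 * \<epsilon>\<^sup>2))" for z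
    unfolding \<rho>_def sq ..
  have cont: "continuous_on (snd \<kappa> ` fst \<kappa>) (chart_inv \<kappa>)" "continuous_on (fst \<kappa>) (snd \<kappa>)"
    using homeomorphism_cont2 homeomorphism_cont1 chart_homeomorphism[OF \<kappa>(1)] by blast+
  have "compact K"
    unfolding K_def
    by (rule compact_continuous_image[OF continuous_on_subset[OF cont(1)] compact_cball_frame[OF B]])
       (use \<epsilon> in auto)
  then have K: "closed K" by (rule compact_imp_closed)
  have KQ: "K \<subseteq> fst \<kappa> \<inter> Q"
    using \<epsilon>(2) chart_image_iff[OF \<kappa>(1)] unfolding K_def by blast
  have zero: "\<beta> q = 0" if "q \<notin> K" for q
  proof (cases "q \<in> fst \<kappa>")
    case True
    then have "snd \<kappa> q \<notin> cball c (2 * \<epsilon>)"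
      using that \<kappa>(1) unfolding K_def by (metis chart_inv_chart image_eqI)
    then have "2 * \<epsilon> \<le> dist c (snd \<kappa> q)" by simp
    from power_mono[OF this, of 2] have "4 * \<epsilon>\<^sup>2 \<le> (dist c (snd \<kappa> q))\<^sup>2"
      using \<epsilon>(1) by (simp add: power_mult_distrib)
    then have "\<rho> (snd \<kappa> q) \<ge> 1" using \<epsilon>(1) by (simp add: \<rho> field_simps)
    then show ?thesis by (simp add: \<beta>_def h(3))
  qed (simp add: \<beta>_def)
  have one: "\<beta> q = 1" if "q \<in> N" for q
  proof -
    have "dist c (snd \<kappa> q) \<le> \<epsilon>" using that by (simp add: N_def)
    from power_mono[OF this, of 2] have "\<rho> (snd \<kappa> q) \<le> 0"
      using \<epsilon>(1) by (simp add: \<rho> field_simps)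
    then show ?thesis using that by (simp add: \<beta>_def N_def h(2))
  qed
  have "smooth_on (snd \<mu> ` (fst \<mu> \<inter> UNIV)) (\<beta> \<circ> chart_inv \<mu>)" if \<mu>: "\<mu> \<in> A" for \<mu>
  proof -
    let ?S = "snd \<mu> ` (fst \<mu> \<inter> fst \<kappa>)" and ?S' = "snd \<mu> ` (fst \<mu> \<inter> - K)"
    have o: "open ?S" "open ?S'"
      using open_chart_image[OF \<mu>] open_chart_domain[OF \<kappa>(1)] K by auto
    have \<tau>: "smooth_on ?S (\<lambda>y. (snd \<kappa> \<circ> chart_inv \<mu>) y + - c)"
      by (rule smooth_on_add[OF o(1) smooth_transition[OF \<mu> \<kappa>(1)] smooth_on_const[OF o(1)]])
    have ip: "smooth_on ?S (\<lambda>y. ((snd \<kappa> \<circ> chart_inv \<mu>) y + - c) \<bullet> ((snd \<kappa> \<circ> chart_inv \<mu>) y + - c))"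
      by (rule smooth_on_bilinear[OF o(1) bounded_bilinear_inner \<tau> \<tau>])
    have "smooth_on ?S (\<lambda>y. h (\<rho> ((snd \<kappa> \<circ> chart_inv \<mu>) y)))"
      unfolding \<rho>_def
      by (rule smooth_on_compose_real[OF o(1) h(1)
            smooth_on_mult[OF o(1) smooth_on_add[OF o(1) ip smooth_on_const[OF o(1)]] smooth_on_const[OF o(1)]]])
    then have "smooth_on ?S (\<beta> \<circ> chart_inv \<mu>)"
      by (rule smooth_on_cong[OF o(1)]) (use \<mu> in \<open>auto simp: \<beta>_def\<close>)
    moreover have "smooth_on ?S' (\<beta> \<circ> chart_inv \<mu>)"
      by (rule smooth_on_cong[OF o(2) smooth_on_const[OF o(2), of 0]]) (use \<mu> zero in auto)
    moreover have "snd \<mu> ` (fst \<mu> \<inter> UNIV) = ?S \<union> ?S'" using KQ by auto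
    ultimately show ?thesis using smooth_on_Un[OF o] by simp
  qed
  then have \<beta>: "smooth_map_on A UNIV \<beta>" unfolding smooth_map_on_def by blast
  have N: "open N" unfolding N_def
    by (rule continuous_open_preimage[OF cont(2) open_chart_domain[OF \<kappa>(1)] open_ball])
  have p: "p \<in> N" using \<kappa> \<epsilon>(1) by (simp add: N_def c_def)
  have "K \<subseteq> Q" using KQ by blast
  from \<beta> K this zero N p one show ?thesis by (rule that)
qed

text \<open>Multiplication by a bump function extends a smooth function from \<open>P \<inter> Q\<close> by zero to \<open>P\<close>;
  \<open>P\<close> is the domain on which smoothness is wanted, \<open>Q\<close> the one on which \<open>g\<close> is meaningful.\<close>

lemma smooth_bump_mult:
  assumes \<mu>: "\<mu> \<in> A" and \<beta>: "smooth_map_on A UNIV \<beta>" "\<And>q. q \<notin> K \<Longrightarrow> \<beta> q = (0::real)"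
    and K: "closed K" "K \<subseteq> Q" and o: "open P" "open Q"
    and g: "smooth_on (snd \<mu> ` (fst \<mu> \<inter> (P \<inter> Q))) g"
  shows "smooth_on (snd \<mu> ` (fst \<mu> \<inter> P)) (\<lambda>x. \<beta> (chart_inv \<mu> x) * g x)"
proof -
  let ?S = "snd \<mu> ` (fst \<mu> \<inter> (P \<inter> Q))" and ?S' = "snd \<mu> ` (fst \<mu> \<inter> (P \<inter> - K))"
  have S: "open ?S" "open ?S'" using o K by (auto intro!: open_chart_image[OF \<mu>])
  have "smooth_on (snd \<mu> ` (fst \<mu> \<inter> UNIV)) (\<beta> \<circ> chart_inv \<mu>)"
    using \<beta>(1) \<mu> unfolding smooth_map_on_def by blast
  then have "smooth_on ?S (\<lambda>x. \<beta> (chart_inv \<mu> x))"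
    unfolding o_def by (rule smooth_on_subset) auto
  then have "smooth_on ?S (\<lambda>x. \<beta> (chart_inv \<mu> x) * g x)"
    by (intro smooth_on_mult S g)
  moreover have "smooth_on ?S' (\<lambda>x. \<beta> (chart_inv \<mu> x) * g x)"
    by (rule smooth_on_cong[OF S(2) smooth_on_const[OF S(2), of 0]]) (use \<mu> \<beta>(2) in auto)
  moreover have "snd \<mu> ` (fst \<mu> \<inter> P) = ?S \<union> ?S'" using K by blast
  ultimately show ?thesis using smooth_on_Un[OF S] by simp
qed

end


section \<open>Vector bundles, frames and sections\<close>

locale bundle_connection = manifold A
  for A :: "('m::{t2_space,second_countable_topology}, 'e::real_inner) chart set" +
  fixes r :: nat
    and V :: "'m \<Rightarrow> 'w::real_vector set"
    and T :: "('m, 'w) triv set"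
    and D :: "('m \<Rightarrow> 'w) \<Rightarrow> ('m, 'e, 'w) form"
  assumes vbundle: "vector_bundle A r V T" and conn: "connection A r V T D"
begin

lemmas vector_bundle_conjuncts =
  vbundle[unfolded vector_bundle_def, THEN conjunct1]
  vbundle[unfolded vector_bundle_def, THEN conjunct2, THEN conjunct1]
  vbundle[unfolded vector_bundle_def, THEN conjunct2, THEN conjunct2, THEN conjunct1]
  vbundle[unfolded vector_bundle_def, THEN conjunct2, THEN conjunct2, THEN conjunct2]

lemma fibre_subspace: "subspace (V q)"
  using vector_bundle_conjuncts(1) by (rule spec)

lemma trivialization_around:
  obtains U \<Phi> where "(U, \<Phi>) \<in> T" "p \<in> U"
proof -
  have "p \<in> (\<Union>t\<in>T. fst t)" unfolding vector_bundle_conjuncts(2) by (rule UNIV_I)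
  then obtain t where "t \<in> T" "p \<in> fst t" by (rule UN_E)
  then show ?thesis using that[of "fst t" "snd t"] by simp
qed

lemma trivialization:
  assumes "(U, \<Phi>) \<in> T"
  shows "open U" and "q \<in> U \<Longrightarrow> bij_betw (\<Phi> q) (V q) (model_fibre r)"
    and "\<lbrakk>q \<in> U; v \<in> V q; w \<in> V q\<rbrakk> \<Longrightarrow>
      \<Phi> q (a *\<^sub>R v + b *\<^sub>R w) i = a * \<Phi> q v i + b * \<Phi> q w i"
proof -
  note t = bspec[OF vector_bundle_conjuncts(3) assms, unfolded prod.case]
  show "open U" using t by (rule conjunct1)
  note tq = bspec[OF conjunct2[OF t]]
  show "bij_betw (\<Phi> q) (V q) (model_fibre r)" if "q \<in> U"
    using tq[OF that] by (rule conjunct1)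
  show "\<Phi> q (a *\<^sub>R v + b *\<^sub>R w) i = a * \<Phi> q v i + b * \<Phi> q w i"
    if "q \<in> U" "v \<in> V q" "w \<in> V q"
    using tq[OF that(1), THEN conjunct2] that(2,3) by simp
qed

lemma transition_entry_smooth:
  assumes "(U, \<Phi>) \<in> T" "(U', \<Phi>') \<in> T" "i < r" "j < r"
  shows "smooth_map_on A (U \<inter> U')
    (\<lambda>q. \<Phi>' q (inv_into (V q) (\<Phi> q) (\<lambda>l. if l = j then 1 else 0)) i)"
  using bspec[OF bspec[OF vector_bundle_conjuncts(4) assms(1), unfolded prod.case] assms(2)] assms(3,4)
  by simp

lemma trivialization_zero:
  assumes "(U, \<Phi>) \<in> T" "q \<in> U"
  shows "\<Phi> q 0 i = 0"
proof -
  have "0 \<in> V q" by (rule subspace_0[OF fibre_subspace])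
  from trivialization(3)[OF assms this this, where a = 0 and b = 0 and i = i] show ?thesis by simp
qed

lemma trivialization_scale:
  assumes "(U, \<Phi>) \<in> T" "q \<in> U" "v \<in> V q"
  shows "\<Phi> q (a *\<^sub>R v) i = a * \<Phi> q v i"
  using trivialization(3)[OF assms(1,2,3,3), where a = a and b = 0 and i = i] by simp

lemma trivialization_sum:
  assumes "(U, \<Phi>) \<in> T" "q \<in> U" "finite I" "\<And>j. j \<in> I \<Longrightarrow> v j \<in> V q"
  shows "\<Phi> q (\<Sum>j\<in>I. a j *\<^sub>R v j) i = (\<Sum>j\<in>I. a j * \<Phi> q (v j) i)"
  using assms(3,4)
proof (induction I rule: finite_induct)
  case empty
  show ?case by (simp add: trivialization_zero[OF assms(1,2)])
next
  case (insert k I)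
  let ?s = "\<Sum>j\<in>I. a j *\<^sub>R v j"
  have k: "v k \<in> V q" using insert.prems by blast
  have s: "?s \<in> V q"
    using insert.prems by (intro subspace_sum subspace_scale fibre_subspace) blast
  have "(\<Sum>j\<in>insert k I. a j *\<^sub>R v j) = a k *\<^sub>R v k + 1 *\<^sub>R ?s"
    using insert.hyps by simp
  moreover have "\<Phi> q ?s i = (\<Sum>j\<in>I. a j * \<Phi> q (v j) i)"
    using insert.IH insert.prems by blast
  ultimately show ?case
    using insert.hyps by (simp only: trivialization(3)[OF assms(1,2) k s]) simp
qed

lemma frame_vector:
  assumes "(U, \<Phi>) \<in> T" "q \<in> U" "j < r"
  defines "\<delta> \<equiv> \<lambda>l. if l = j then 1 else (0::real)"
  shows "inv_into (V q) (\<Phi> q) \<delta> \<in> V q" "\<Phi> q (inv_into (V q) (\<Phi> q) \<delta>) = \<delta>"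
proof -
  have im: "\<Phi> q ` V q = model_fibre r"
    by (rule bij_betw_imp_surj_on[OF trivialization(2)[OF assms(1,2)]])
  have "\<delta> \<in> model_fibre r" using assms(3) by (auto simp: \<delta>_def model_fibre_def)
  then have \<delta>: "\<delta> \<in> \<Phi> q ` V q" unfolding im .
  show "inv_into (V q) (\<Phi> q) \<delta> \<in> V q" by (rule inv_into_into[OF \<delta>])
  show "\<Phi> q (inv_into (V q) (\<Phi> q) \<delta>) = \<delta>" by (rule f_inv_into_f[OF \<delta>])
qed

lemma frame_expansion:
  assumes "(U, \<Phi>) \<in> T" "q \<in> U" "v \<in> V q"
  shows "(\<Sum>j<r. \<Phi> q v j *\<^sub>R inv_into (V q) (\<Phi> q) (\<lambda>l. if l = j then 1 else 0)) = v"
    (is "?s = v")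
proof -
  have bij: "bij_betw (\<Phi> q) (V q) (model_fibre r)" by (rule trivialization(2)[OF assms(1,2)])
  have sV: "?s \<in> V q"
    using frame_vector(1)[OF assms(1,2)] by (intro subspace_sum subspace_scale fibre_subspace) auto
  have "\<Phi> q ?s i = \<Phi> q v i" for i
  proof -
    have "\<Phi> q ?s i = (\<Sum>j<r. \<Phi> q v j * (if i = j then 1 else 0))"
      using frame_vector[OF assms(1,2)] by (subst trivialization_sum[OF assms(1,2)]) auto
    also have "\<dots> = (if i < r then \<Phi> q v i else 0)"
      by (simp add: if_distrib cong: if_cong)
    also have "\<dots> = \<Phi> q v i"
      using bij_betw_apply[OF bij assms(3)] by (simp add: model_fibre_def)
    finally show ?thesis .
  qed
  then have "\<Phi> q ?s = \<Phi> q v" by blast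
  then show ?thesis
    using bij_betw_imp_inj_on[OF bij] sV assms(3) by (meson inj_onD)
qed

lemma section_fibre: "s \<in> smooth_sections A r V T \<Longrightarrow> s q \<in> V q"
  unfolding smooth_sections_def by blast

lemma section_smooth:
  "s \<in> smooth_sections A r V T \<Longrightarrow> (U, \<Phi>) \<in> T \<Longrightarrow> i < r \<Longrightarrow> \<kappa> \<in> A \<Longrightarrow>
    smooth_on (snd \<kappa> ` (fst \<kappa> \<inter> U)) (\<lambda>x. \<Phi> (chart_inv \<kappa> x) (s (chart_inv \<kappa> x)) i)"
  unfolding smooth_sections_def smooth_map_on_def by (fastforce simp: o_def)

lemma sectionI:
  assumes "\<And>q. s q \<in> V q"
    and "\<And>U \<Phi> i \<kappa>. (U, \<Phi>) \<in> T \<Longrightarrow> i < r \<Longrightarrow> \<kappa> \<in> A \<Longrightarrow>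
      smooth_on (snd \<kappa> ` (fst \<kappa> \<inter> U)) (\<lambda>x. \<Phi> (chart_inv \<kappa> x) (s (chart_inv \<kappa> x)) i)"
  shows "s \<in> smooth_sections A r V T"
  using assms unfolding smooth_sections_def smooth_map_on_def o_def by blast

lemma section_combination:
  assumes s: "s \<in> smooth_sections A r V T" and t: "t \<in> smooth_sections A r V T"
  shows "(\<lambda>q. a *\<^sub>R s q + b *\<^sub>R t q) \<in> smooth_sections A r V T"
proof (rule sectionI)
  show "a *\<^sub>R s q + b *\<^sub>R t q \<in> V q" for q
    by (intro subspace_add subspace_scale fibre_subspace section_fibre s t)
  fix U \<Phi> i and \<kappa> :: "('m, 'e) chart" assume U: "(U, \<Phi>) \<in> T" and i: "i < r" and \<kappa>: "\<kappa> \<in> A"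
  have o: "open (snd \<kappa> ` (fst \<kappa> \<inter> U))" by (rule open_chart_image[OF \<kappa> trivialization(1)[OF U]])
  show "smooth_on (snd \<kappa> ` (fst \<kappa> \<inter> U))
      (\<lambda>x. \<Phi> (chart_inv \<kappa> x) (a *\<^sub>R s (chart_inv \<kappa> x) + b *\<^sub>R t (chart_inv \<kappa> x)) i)"
    by (rule smooth_on_cong[OF o smooth_on_add[OF o
            smooth_on_mult[OF o smooth_on_const[OF o, of a] section_smooth[OF s U i \<kappa>]]
            smooth_on_mult[OF o smooth_on_const[OF o, of b] section_smooth[OF t U i \<kappa>]]]])
       (use \<kappa> trivialization(3)[OF U] section_fibre[OF s] section_fibre[OF t] in auto)
qed

lemma section_scale:
  assumes f: "smooth_map_on A UNIV f" and s: "s \<in> smooth_sections A r V T"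
  shows "(\<lambda>q. f q *\<^sub>R s q) \<in> smooth_sections A r V T"
proof (rule sectionI)
  show "f q *\<^sub>R s q \<in> V q" for q
    by (intro subspace_scale fibre_subspace section_fibre s)
  fix U \<Phi> i and \<kappa> :: "('m, 'e) chart" assume U: "(U, \<Phi>) \<in> T" and i: "i < r" and \<kappa>: "\<kappa> \<in> A"
  have o: "open (snd \<kappa> ` (fst \<kappa> \<inter> U))" by (rule open_chart_image[OF \<kappa> trivialization(1)[OF U]])
  have "smooth_on (snd \<kappa> ` (fst \<kappa> \<inter> UNIV)) (f \<circ> chart_inv \<kappa>)"
    using f \<kappa> unfolding smooth_map_on_def by blast
  then have f': "smooth_on (snd \<kappa> ` (fst \<kappa> \<inter> U)) (\<lambda>x. f (chart_inv \<kappa> x))"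
    unfolding o_def by (rule smooth_on_subset) auto
  show "smooth_on (snd \<kappa> ` (fst \<kappa> \<inter> U)) (\<lambda>x. \<Phi> (chart_inv \<kappa> x) (f (chart_inv \<kappa> x) *\<^sub>R s (chart_inv \<kappa> x)) i)"
    by (rule smooth_on_cong[OF o smooth_on_mult[OF o f' section_smooth[OF s U i \<kappa>]]])
       (use \<kappa> trivialization_scale[OF U] section_fibre[OF s] in auto)
qed

lemma section_zero: "(\<lambda>q. 0) \<in> smooth_sections A r V T"
proof (rule sectionI)
  show "0 \<in> V q" for q by (rule subspace_0[OF fibre_subspace])
  fix U \<Phi> i and \<kappa> :: "('m, 'e) chart" assume U: "(U, \<Phi>) \<in> T" and i: "i < r" and \<kappa>: "\<kappa> \<in> A"
  have o: "open (snd \<kappa> ` (fst \<kappa> \<inter> U))" by (rule open_chart_image[OF \<kappa> trivialization(1)[OF U]])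
  show "smooth_on (snd \<kappa> ` (fst \<kappa> \<inter> U)) (\<lambda>x. \<Phi> (chart_inv \<kappa> x) 0 i)"
    by (rule smooth_on_cong[OF o smooth_on_const[OF o, of 0]])
       (use \<kappa> trivialization_zero[OF U] in auto)
qed

lemma section_sum:
  fixes n :: nat
  assumes "\<And>j. j < n \<Longrightarrow> s j \<in> smooth_sections A r V T"
  shows "(\<lambda>q. \<Sum>j<n. s j q) \<in> smooth_sections A r V T"
  using assms
proof (induction n)
  case (Suc n)
  then show ?case
    using section_combination[of "\<lambda>q. \<Sum>j<n. s j q" "s n" 1 1] by simp
qed (simp add: section_zero)

text \<open>Cutting off the frame of a trivialization gives global sections that still form a frame near
  the given point. The bump function is exported because it also cuts off coefficients.\<close>

lemma local_frame:
  assumes U: "(U, \<Phi>) \<in> T" and "p \<in> U"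
  obtains \<beta> :: "'m \<Rightarrow> real" and K N e where "smooth_map_on A UNIV \<beta>" "closed K" "K \<subseteq> U"
    "\<And>q. q \<notin> K \<Longrightarrow> \<beta> q = 0" "open N" "p \<in> N" "N \<subseteq> U" "\<And>q. q \<in> N \<Longrightarrow> \<beta> q = 1"
    "\<And>j. j < r \<Longrightarrow> e j \<in> smooth_sections A r V T"
    "\<And>q v. q \<in> N \<Longrightarrow> v \<in> V q \<Longrightarrow> (\<Sum>j<r. \<Phi> q v j *\<^sub>R e j q) = v"
proof -
  obtain \<beta> :: "'m \<Rightarrow> real" and K N where \<beta>: "smooth_map_on A UNIV \<beta>" and K: "closed K" "K \<subseteq> U"
    and \<beta>0: "\<And>q. q \<notin> K \<Longrightarrow> \<beta> q = 0" and N: "open N" "p \<in> N" and \<beta>1: "\<And>q. q \<in> N \<Longrightarrow> \<beta> q = 1"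
    using bump_function[OF trivialization(1)[OF U] assms(2)] by metis
  have NU: "N \<subseteq> U" using \<beta>0 \<beta>1 K(2) by force
  define b where "b j q = inv_into (V q) (\<Phi> q) (\<lambda>l. if l = j then 1 else 0)" for j q
  define e where "e j q = \<beta> q *\<^sub>R b j q" for j q
  have sec: "e j \<in> smooth_sections A r V T" if j: "j < r" for j
  proof (rule sectionI)
    show "e j q \<in> V q" for q
    proof (cases "q \<in> U")
      case True
      then show ?thesis using frame_vector(1)[OF U True j]
        by (simp add: e_def b_def subspace_scale fibre_subspace)
    next
      case False
      then have "\<beta> q = 0" using \<beta>0 K by blast
      then show ?thesis by (simp add: e_def subspace_0 fibre_subspace)
    qed
    fix U' \<Phi>' i and \<kappa> :: "('m, 'e) chart" assume U': "(U', \<Phi>') \<in> T" and i: "i < r" and \<kappa>: "\<kappa> \<in> A"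
    have o: "open (snd \<kappa> ` (fst \<kappa> \<inter> U'))" by (rule open_chart_image[OF \<kappa> trivialization(1)[OF U']])
    have "smooth_map_on A (U \<inter> U') (\<lambda>q. \<Phi>' q (b j q) i)"
      unfolding b_def by (rule transition_entry_smooth[OF U U' i j])
    then have "smooth_on (snd \<kappa> ` (fst \<kappa> \<inter> (U' \<inter> U))) (\<lambda>x. \<Phi>' (chart_inv \<kappa> x) (b j (chart_inv \<kappa> x)) i)"
      using \<kappa> unfolding smooth_map_on_def o_def by (simp add: Int_commute)
    note sm = smooth_bump_mult[OF \<kappa> \<beta> \<beta>0 K trivialization(1)[OF U'] trivialization(1)[OF U] this]
    have eq: "\<beta> q * \<Phi>' q (b j q) i = \<Phi>' q (e j q) i" if "q \<in> U'" for q
    proof (cases "q \<in> U")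
      case True
      then show ?thesis unfolding e_def b_def
        using trivialization_scale[OF U' that frame_vector(1)[OF U True j]] by simp
    next
      case False
      then have "\<beta> q = 0" using \<beta>0 K by blast
      then show ?thesis using trivialization_zero[OF U' that] by (simp add: e_def)
    qed
    show "smooth_on (snd \<kappa> ` (fst \<kappa> \<inter> U')) (\<lambda>x. \<Phi>' (chart_inv \<kappa> x) (e j (chart_inv \<kappa> x)) i)"
      by (rule smooth_on_cong[OF o sm]) (use eq \<kappa> in auto)
  qed
  have ex: "(\<Sum>j<r. \<Phi> q v j *\<^sub>R e j q) = v" if "q \<in> N" "v \<in> V q" for q v
  proof -
    have "q \<in> U" using NU that by blast
    from frame_expansion[OF U this that(2)] show ?thesis
      using \<beta>1[OF that(1)] by (simp add: e_def b_def)
  qed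
  from \<beta> K \<beta>0 N NU \<beta>1 sec ex show ?thesis by (rule that)
qed


section \<open>Connections in a local frame\<close>

lemmas connection_conjuncts =
  conn[unfolded connection_def, THEN conjunct1]
  conn[unfolded connection_def, THEN conjunct2, THEN conjunct1]
  conn[unfolded connection_def, THEN conjunct2, THEN conjunct2]

lemma connection_forms:
  assumes "s \<in> smooth_sections A r V T"
  shows "D s \<in> bundle_forms A r V T" "homogeneous 1 (D s)"
  using bspec[OF connection_conjuncts(1) assms] by simp_all

lemma connection_combination:
  assumes "s \<in> smooth_sections A r V T" "t \<in> smooth_sections A r V T"
  shows "D (\<lambda>q. a *\<^sub>R s q + b *\<^sub>R t q) = (\<lambda>q vs. a *\<^sub>R D s q vs + b *\<^sub>R D t q vs)"
  by (rule spec[OF spec[OF bspec[OF bspec[OF connection_conjuncts(2) assms(1)] assms(2)]]])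

lemma connection_leibniz:
  assumes "smooth_map_on A UNIV f" "s \<in> smooth_sections A r V T"
  shows "D (\<lambda>q. f q *\<^sub>R s q) q vs = ext_deriv A (function_form f) q vs *\<^sub>R s q + f q *\<^sub>R D s q vs"
  using fun_cong[OF fun_cong[OF mp[OF bspec[OF spec[OF connection_conjuncts(3), of f] assms(2)] assms(1)]], of q vs]
  unfolding tensor_section_def .

lemma connection_zero: "D (\<lambda>q. 0) q vs = 0"
  using connection_combination[OF section_zero section_zero, of 0 0] by simp

lemma connection_sum:
  fixes n :: nat
  assumes "\<And>j. j < n \<Longrightarrow> s j \<in> smooth_sections A r V T"
  shows "D (\<lambda>q. \<Sum>j<n. s j q) q vs = (\<Sum>j<n. D (s j) q vs)"
  using assms
proof (induction n)
  case (Suc n)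
  then show ?case
    using connection_combination[OF section_sum[of n s], of "s n" 1 1] by simp
qed (simp add: connection_zero)

text \<open>If \<open>s - t\<close> vanishes near \<open>p\<close>, then so does its product with a bump function \<open>\<beta>\<close> supported there,
  everywhere on \<open>M\<close>; the Leibniz rule at \<open>p\<close> gives \<open>0 = D (\<beta> (s - t)) = D (s - t)\<close>.\<close>

lemma connection_local:
  assumes s: "s \<in> smooth_sections A r V T" and t: "t \<in> smooth_sections A r V T"
    and N: "open N" "p \<in> N" and eq: "\<And>q. q \<in> N \<Longrightarrow> s q = t q"
  shows "D s p vs = D t p vs"
proof -
  obtain \<beta> :: "'m \<Rightarrow> real" and K N' where \<beta>: "smooth_map_on A UNIV \<beta>" "closed K" "K \<subseteq> N"
    "\<And>q. q \<notin> K \<Longrightarrow> \<beta> q = 0" "open N'" "p \<in> N'" "\<And>q. q \<in> N' \<Longrightarrow> \<beta> q = 1"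
    using bump_function[OF N] by metis
  define u where "u q = 1 *\<^sub>R s q + (- 1) *\<^sub>R t q" for q
  have u: "u \<in> smooth_sections A r V T"
    unfolding u_def by (rule section_combination[OF s t])
  have z: "\<beta> q *\<^sub>R u q = 0" for q
    using \<beta>(3,4) eq by (cases "q \<in> N") (auto simp: u_def)
  have "0 = D (\<lambda>q. \<beta> q *\<^sub>R u q) p vs" by (simp add: z connection_zero)
  also have "\<dots> = D u p vs"
  proof -
    have "u p = 0" using eq[OF N(2)] by (simp add: u_def)
    then show ?thesis using \<beta>(7)[OF \<beta>(6)] by (simp add: connection_leibniz[OF \<beta>(1) u])
  qed
  also have "\<dots> = D s p vs - D t p vs"
    unfolding u_def[abs_def] connection_combination[OF s t] by simp
  finally show ?thesis by simp
qed

end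


section \<open>The covariant derivative of a form in a local frame\<close>

lemma twisted_deriv_mult:
  assumes "t differentiable (at x)" "f differentiable (at x)"
  shows "twisted_deriv e \<theta> x (\<lambda>y. t y * f y) v =
    (frechet_derivative t (at x) v * f x) *\<^sub>R e + t x *\<^sub>R twisted_deriv e \<theta> x f v"
proof -
  have "frechet_derivative (\<lambda>y. t y * f y) (at x) v =
      t x * frechet_derivative f (at x) v + frechet_derivative t (at x) v * f x"
    by (rule frechet_derivative_apply[OF has_derivative_mult
          [OF has_frechet_derivative[OF assms(1)] has_frechet_derivative[OF assms(2)]]])
  then show ?thesis by (simp add: twisted_deriv_def scaleR_add_left scaleR_add_right)
qed

lemma twisted_deriv_sum:
  assumes "open S" "x \<in> S" "\<And>y. y \<in> S \<Longrightarrow> f y = (\<Sum>i\<in>I. g i y)"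
    and g: "\<And>i. i \<in> I \<Longrightarrow> g i differentiable (at x)"
  shows "twisted_deriv e \<theta> x f v = (\<Sum>i\<in>I. twisted_deriv e \<theta> x (g i) v)"
proof -
  have "((\<lambda>y. \<Sum>i\<in>I. g i y) has_derivative (\<lambda>v. \<Sum>i\<in>I. frechet_derivative (g i) (at x) v)) (at x)"
    by (rule has_derivative_sum) (rule has_frechet_derivative[OF g])
  then have "(f has_derivative (\<lambda>v. \<Sum>i\<in>I. frechet_derivative (g i) (at x) v)) (at x)"
    by (rule has_derivative_transform_within_open[OF _ assms(1,2)]) (simp add: assms(3))
  note f = frechet_derivative_apply[OF this]
  show ?thesis
    unfolding twisted_deriv_def f assms(3)[OF assms(2)] scaleR_sum_left sum.distrib ..
qed

lemma twisted_ext_deriv_sum: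
  assumes "open S" "x \<in> S" "\<And>y es. y \<in> S \<Longrightarrow> W y es = (\<Sum>i\<in>I. W' i y es)"
    and "\<And>i es. i \<in> I \<Longrightarrow> (\<lambda>y. W' i y es) differentiable (at x)"
  shows "twisted_ext_deriv e \<theta> x W es = (\<Sum>i\<in>I. twisted_ext_deriv e \<theta> x (W' i) es)"
proof -
  have "twisted_ext_deriv e \<theta> x W es = (\<Sum>l<length es. \<Sum>i\<in>I.
      (-1) ^ l *\<^sub>R twisted_deriv e \<theta> x (\<lambda>y. W' i y (drop_nth l es)) (es ! l))"
    unfolding twisted_ext_deriv_def scaleR_sum_right[symmetric]
    by (intro sum.cong refl arg_cong[where f = "scaleR _"] twisted_deriv_sum[OF assms(1,2)] assms(3,4))
  also have "\<dots> = (\<Sum>i\<in>I. twisted_ext_deriv e \<theta> x (W' i) es)"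
    unfolding twisted_ext_deriv_def by (rule sum.swap)
  finally show ?thesis .
qed

lemma twisted_ext_deriv_cong:
  assumes "open S" "x \<in> S" "\<And>y es. y \<in> S \<Longrightarrow> W y es = W' y es"
    and "\<And>es. (\<lambda>y. W' y es) differentiable (at x)"
  shows "twisted_ext_deriv e \<theta> x W es = twisted_ext_deriv e \<theta> x W' es"
  by (rule trans[OF twisted_ext_deriv_sum[OF assms(1,2), where I = "{()}" and W' = "\<lambda>_. W'"]])
     (use assms(3,4) in simp_all)

definition chart_form ::
    "('m, 'e::real_normed_vector) chart set \<Rightarrow> ('m, 'e) chart \<Rightarrow> ('m, 'e, 'b) form \<Rightarrow> 'e \<Rightarrow> 'e list \<Rightarrow> 'b" where
  "chart_form A \<kappa> \<omega> x es = \<omega> (chart_inv \<kappa> x) (map (coord_vec A \<kappa> (chart_inv \<kappa> x)) es)"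

definition component ::
    "('m, 'e::real_normed_vector) chart set \<Rightarrow> ('m, 'e) chart \<Rightarrow> ('m \<Rightarrow> 'w \<Rightarrow> nat \<Rightarrow> real) \<Rightarrow> nat \<Rightarrow>
      ('m, 'e, 'w) form \<Rightarrow> 'e \<Rightarrow> 'e list \<Rightarrow> real" where
  "component A \<kappa> \<Phi> j \<omega> x es = \<Phi> (chart_inv \<kappa> x) (chart_form A \<kappa> \<omega> x es) j"

context manifold
begin

lemma scalar_formD:
  assumes "\<tau> \<in> scalar_forms A k"
  shows "homogeneous k \<tau>" and "alternating_on (tangent_space A q) UNIV (\<tau> q)"
    and "\<kappa> \<in> A \<Longrightarrow> smooth_on (snd \<kappa> ` fst \<kappa>) (\<lambda>x. chart_form A \<kappa> \<tau> x es)"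
  using assms unfolding scalar_forms_def chart_form_def by simp_all

lemma chart_form_at:
  assumes "\<kappa> \<in> A" "p \<in> fst \<kappa>" "set vs \<subseteq> tangent_space A p"
  shows "chart_form A \<kappa> \<omega> (snd \<kappa> p) (map (\<lambda>v. v \<kappa>) vs) = \<omega> p vs"
  unfolding chart_form_def chart_inv_chart[OF assms(1,2)] map_coord_vec_of_tangent[OF assms] ..

lemma set_drop_nth_subset: "set (drop_nth i vs) \<subseteq> set vs"
  by (auto simp: drop_nth_def dest: in_set_takeD in_set_dropD)

lemma ext_deriv_in_chart:
  assumes "set vs \<subseteq> tangent_space A p"
  defines "\<kappa> \<equiv> chart_at A p"
  shows "ext_deriv A \<tau> p vs = (\<Sum>i<length vs. (-1) ^ i *
    frechet_derivative (\<lambda>x. chart_form A \<kappa> \<tau> x (drop_nth i (map (\<lambda>v. v \<kappa>) vs))) (at (snd \<kappa> p)) ((vs ! i) \<kappa>))"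
  using assms(1) by (simp add: ext_deriv_def chart_form_def Let_def o_def flip: \<kappa>_def map_drop_nth)

end

context bundle_connection
begin

lemma bundle_formD:
  assumes "\<omega> \<in> bundle_forms A r V T"
  shows "alternating_on (tangent_space A q) (V q) (\<omega> q)"
    and "\<lbrakk>\<kappa> \<in> A; (U, \<Phi>) \<in> T; j < r\<rbrakk> \<Longrightarrow>
      smooth_on (snd \<kappa> ` (fst \<kappa> \<inter> U)) (\<lambda>x. component A \<kappa> \<Phi> j \<omega> x es)"
proof -
  note w = assms[unfolded bundle_forms_def mem_Collect_eq]
  show "alternating_on (tangent_space A q) (V q) (\<omega> q)"
    by (rule spec[OF conjunct1[OF w]])
  show "smooth_on (snd \<kappa> ` (fst \<kappa> \<inter> U)) (\<lambda>x. component A \<kappa> \<Phi> j \<omega> x es)"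
    if "\<kappa> \<in> A" "(U, \<Phi>) \<in> T" "j < r"
    using bspec[OF bspec[OF conjunct2[OF w] that(1)] that(2), unfolded prod.case] that(3)
    unfolding component_def chart_form_def by simp
qed

lemma bundle_formI:
  assumes "\<And>q. alternating_on (tangent_space A q) (V q) (\<omega> q)"
    and "\<And>\<kappa> U \<Phi> j es. \<lbrakk>\<kappa> \<in> A; (U, \<Phi>) \<in> T; j < r\<rbrakk> \<Longrightarrow>
      smooth_on (snd \<kappa> ` (fst \<kappa> \<inter> U)) (\<lambda>x. component A \<kappa> \<Phi> j \<omega> x es)"
  shows "\<omega> \<in> bundle_forms A r V T"
  unfolding bundle_forms_def mem_Collect_eq
  by (intro conjI allI ballI impI assms(1)) (use assms(2) in \<open>force simp: component_def chart_form_def\<close>)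

lemma component_alternating:
  assumes \<omega>: "\<omega> \<in> bundle_forms A r V T" and \<kappa>: "\<kappa> \<in> A" and U: "(U, \<Phi>) \<in> T"
    and x: "x \<in> snd \<kappa> ` (fst \<kappa> \<inter> U)"
  shows "alternating_map (component A \<kappa> \<Phi> j \<omega> x)"
proof -
  let ?q = "chart_inv \<kappa> x"
  have q: "?q \<in> fst \<kappa>" "?q \<in> U" using x chart_image_iff[OF \<kappa>] by blast+
  have alt: "alternating_map (chart_form A \<kappa> \<omega> x)"
    using alternating_map_of_alternating_on[OF bundle_formD(1)[OF \<omega>] \<kappa> q(1)]
    unfolding chart_form_def[abs_def] .
  have fib: "chart_form A \<kappa> \<omega> x es \<in> V ?q" for es
    unfolding chart_form_def by (rule alternating_onD(1)[OF bundle_formD(1)[OF \<omega>]])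
  show ?thesis
    unfolding alternating_map_def
  proof (intro conjI allI impI)
    fix us v w vs and a b :: real
    have "chart_form A \<kappa> \<omega> x (us @ (a *\<^sub>R v + b *\<^sub>R w) # vs) =
        a *\<^sub>R chart_form A \<kappa> \<omega> x (us @ v # vs) + b *\<^sub>R chart_form A \<kappa> \<omega> x (us @ w # vs)"
      using alt unfolding alternating_map_def by blast
    then show "component A \<kappa> \<Phi> j \<omega> x (us @ (a *\<^sub>R v + b *\<^sub>R w) # vs) =
        a *\<^sub>R component A \<kappa> \<Phi> j \<omega> x (us @ v # vs) + b *\<^sub>R component A \<kappa> \<Phi> j \<omega> x (us @ w # vs)"
      by (simp add: component_def trivialization(3)[OF U q(2) fib fib])
  next
    fix vs :: "'e list" and i k assume "i < k \<and> k < length vs \<and> vs ! i = vs ! k"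
    then have "chart_form A \<kappa> \<omega> x vs = 0" using alternating_map_repeat[OF alt] by blast
    then show "component A \<kappa> \<Phi> j \<omega> x vs = 0"
      by (simp add: component_def trivialization_zero[OF U q(2)])
  qed
qed

lemma component_contract:
  assumes X: "smooth_vector_field A X" and \<kappa>: "\<kappa> \<in> A" and "x \<in> snd \<kappa> ` fst \<kappa>"
  shows "component A \<kappa> \<Phi> j (contract X \<omega>) x es = component A \<kappa> \<Phi> j \<omega> x (X (chart_inv \<kappa> x) \<kappa> # es)"
proof -
  have "chart_inv \<kappa> x \<in> fst \<kappa>" using assms(3) \<kappa> by auto
  from vector_field_coord_vec[OF X \<kappa> this] show ?thesis
    by (simp add: component_def chart_form_def contract_def)
qed

text \<open>Smoothness of \<open>X \<lrcorner> \<omega>\<close> follows by expanding \<open>X\<close> in a fixed frame of the model space, since only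
  components on constant vectors are known to be smooth.\<close>

lemma contract_bundle_form:
  assumes X: "smooth_vector_field A X" and \<omega>: "\<omega> \<in> bundle_forms A r V T"
  shows "contract X \<omega> \<in> bundle_forms A r V T"
proof (rule bundle_formI)
  fix q
  have Xq: "X q \<in> tangent_space A q" using X unfolding smooth_vector_field_def by blast
  note alt = alternating_onD[OF bundle_formD(1)[OF \<omega>, of q]]
  show "alternating_on (tangent_space A q) (V q) (contract X \<omega> q)"
    unfolding alternating_on_def contract_def
  proof (intro conjI allI impI)
    show "\<omega> q (X q # vs) \<in> V q" for vs by (rule alt(1))
    show "\<omega> q (X q # vs) = 0" if "\<not> set vs \<subseteq> tangent_space A q" for vs
      by (rule alt(2)) (use that in auto)
    show "\<omega> q (X q # us @ (\<lambda>\<kappa>. a *\<^sub>R v \<kappa> + b *\<^sub>R w \<kappa>) # vs) =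
        a *\<^sub>R \<omega> q (X q # us @ v # vs) + b *\<^sub>R \<omega> q (X q # us @ w # vs)"
      if "set us \<subseteq> tangent_space A q \<and> v \<in> tangent_space A q \<and> w \<in> tangent_space A q \<and>
        set vs \<subseteq> tangent_space A q" for us v w vs a b
      using alt(3)[of "X q # us" v w vs a b] that Xq by simp
    show "\<omega> q (X q # vs) = 0"
      if "set vs \<subseteq> tangent_space A q \<and> i < j \<and> j < length vs \<and> vs ! i = vs ! j" for vs i j
      by (rule alt(4)[of _ "Suc i" "Suc j"]) (use that Xq in auto)
  qed
next
  fix \<kappa> :: "('m, 'e) chart" and U \<Phi> j es assume \<kappa>: "\<kappa> \<in> A" and U: "(U, \<Phi>) \<in> T" and j: "j < r"
  obtain B where B: "parseval_frame (B::'e set)" by (rule frame_exists)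
  let ?S = "snd \<kappa> ` (fst \<kappa> \<inter> U)" and ?X = "\<lambda>x. X (chart_inv \<kappa> x) \<kappa>"
  have o: "open ?S" by (rule open_chart_image[OF \<kappa> trivialization(1)[OF U]])
  have sX: "smooth_on ?S ?X"
    by (rule smooth_on_subset[OF vector_field_smooth[OF X \<kappa>]]) blast
  have "smooth_on ?S (\<lambda>x. \<Sum>b\<in>B. (?X x \<bullet> b) * component A \<kappa> \<Phi> j \<omega> x (b # es))"
    by (rule smooth_on_sum[OF o smooth_on_mult[OF o
          smooth_on_linear[OF o bounded_linear_inner_left sX] bundle_formD(2)[OF \<omega> \<kappa> U j]]])
  then show "smooth_on ?S (\<lambda>x. component A \<kappa> \<Phi> j (contract X \<omega>) x es)"
  proof (rule smooth_on_cong[OF o])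
    fix x assume x: "x \<in> ?S"
    note lin = alternating_map_linear_hd[OF component_alternating[OF \<omega> \<kappa> U x]]
    have "component A \<kappa> \<Phi> j \<omega> x (?X x # es) =
        component A \<kappa> \<Phi> j \<omega> x ((\<Sum>b\<in>B. (?X x \<bullet> b) *\<^sub>R b) # es)"
      using B unfolding parseval_frame_def by simp
    also have "\<dots> = (\<Sum>b\<in>B. (?X x \<bullet> b) * component A \<kappa> \<Phi> j \<omega> x (b # es))"
      unfolding linear_sum[OF lin] linear_scale[OF lin] by simp
    finally show "(\<Sum>b\<in>B. (?X x \<bullet> b) * component A \<kappa> \<Phi> j \<omega> x (b # es)) =
        component A \<kappa> \<Phi> j (contract X \<omega>) x es"
      using component_contract[OF X \<kappa>, of x \<Phi> j \<omega> es] x by auto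
  qed
qed

end


text \<open>On the neighbourhood \<open>N\<close> of \<open>p\<close> cutting off has no effect: there the global sections \<open>e j\<close> form a frame, and
  the coefficients in this frame are those given by the trivialization \<open>\<Phi>\<close>.\<close>

locale framed_point = bundle_connection A r V T D
  for A :: "('m::{t2_space,second_countable_topology}, 'e::real_inner) chart set"
    and r V T and D :: "('m \<Rightarrow> 'w::real_vector) \<Rightarrow> ('m, 'e, 'w) form" +
  fixes U :: "'m set" and \<Phi> :: "'m \<Rightarrow> 'w \<Rightarrow> nat \<Rightarrow> real" and p :: 'm
    and \<beta> :: "'m \<Rightarrow> real" and K N :: "'m set" and e :: "nat \<Rightarrow> 'm \<Rightarrow> 'w"
  assumes triv: "(U, \<Phi>) \<in> T"
    and bump_smooth: "smooth_map_on A UNIV \<beta>"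
    and bump_support: "closed K" "K \<subseteq> U" "\<And>q. q \<notin> K \<Longrightarrow> \<beta> q = 0"
    and nbhd: "open N" "p \<in> N" "N \<subseteq> U"
    and bump_one: "\<And>q. q \<in> N \<Longrightarrow> \<beta> q = 1"
    and frame_sections: "\<And>j. j < r \<Longrightarrow> e j \<in> smooth_sections A r V T"
    and frame_expand: "\<And>q v. q \<in> N \<Longrightarrow> v \<in> V q \<Longrightarrow> (\<Sum>j<r. \<Phi> q v j *\<^sub>R e j q) = v"
begin

abbreviation "\<kappa> \<equiv> chart_at A p"
abbreviation "\<theta> j v \<equiv> D (e j) p [coord_vec A \<kappa> p v]"
abbreviation "coords vs \<equiv> map (\<lambda>v. v \<kappa>) vs"

lemmas \<kappa> = chart_at[of p]

lemma nbhd_image: "open (snd \<kappa> ` (fst \<kappa> \<inter> N))" "snd \<kappa> p \<in> snd \<kappa> ` (fst \<kappa> \<inter> N)"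
  using open_chart_image[OF \<kappa>(1) nbhd(1)] \<kappa>(2) nbhd(2) by auto

lemma ext_deriv_function_form:
  "ext_deriv A (function_form f) p [coord_vec A \<kappa> p v] =
    frechet_derivative (\<lambda>x. f (chart_inv \<kappa> x)) (at (snd \<kappa> p)) v"
proof -
  have "set [coord_vec A \<kappa> p v] \<subseteq> tangent_space A p"
    using coord_vec_tangent[OF \<kappa>] by simp
  from ext_deriv_in_chart[OF this, of "function_form f"] show ?thesis
    by (simp add: coord_vec_same[OF \<kappa>] chart_form_def function_form_def)
qed

text \<open>Global smoothness of the cut-off coefficients is what makes the Leibniz rule of the connection
  applicable to the expansion of \<open>s\<close> in the frame.\<close>

lemma connection_in_frame:
  assumes s: "s \<in> smooth_sections A r V T"
  shows "D s p [coord_vec A \<kappa> p v] =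
    (\<Sum>j<r. twisted_deriv (e j p) (\<theta> j) (snd \<kappa> p) (\<lambda>x. \<Phi> (chart_inv \<kappa> x) (s (chart_inv \<kappa> x)) j) v)"
proof -
  define F where "F j q = \<beta> q * \<Phi> q (s q) j" for j q
  have F: "smooth_map_on A UNIV (F j)" if "j < r" for j
    unfolding smooth_map_on_def
  proof
    fix \<mu> assume \<mu>: "\<mu> \<in> A"
    show "smooth_on (snd \<mu> ` (fst \<mu> \<inter> UNIV)) (F j \<circ> chart_inv \<mu>)"
      unfolding o_def F_def
      by (rule smooth_bump_mult[OF \<mu> bump_smooth _ bump_support(1,2) open_UNIV trivialization(1)[OF triv]])
         (use bump_support(3) section_smooth[OF s triv that \<mu>] in auto)
  qed
  have FN: "F j q = \<Phi> q (s q) j" if "q \<in> N" for j q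
    using bump_one[OF that] by (simp add: F_def)
  have Fe: "(\<lambda>q. F j q *\<^sub>R e j q) \<in> smooth_sections A r V T" if "j < r" for j
    by (rule section_scale[OF F[OF that] frame_sections[OF that]])
  have "D s p [coord_vec A \<kappa> p v] = D (\<lambda>q. \<Sum>j<r. F j q *\<^sub>R e j q) p [coord_vec A \<kappa> p v]"
    by (rule connection_local[OF s section_sum nbhd(1,2)])
       (use Fe frame_expand section_fibre[OF s] FN in auto)
  also have "\<dots> = (\<Sum>j<r. D (\<lambda>q. F j q *\<^sub>R e j q) p [coord_vec A \<kappa> p v])"
    by (rule connection_sum[OF Fe])
  also have "\<dots> = (\<Sum>j<r. twisted_deriv (e j p) (\<theta> j) (snd \<kappa> p) (\<lambda>x. \<Phi> (chart_inv \<kappa> x) (s (chart_inv \<kappa> x)) j) v)"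
  proof (rule sum.cong[OF refl])
    fix j assume "j \<in> {..<r}"
    then have j: "j < r" by simp
    have "smooth_on (snd \<kappa> ` (fst \<kappa> \<inter> UNIV)) (\<lambda>x. F j (chart_inv \<kappa> x))"
      using F[OF j] \<kappa>(1) unfolding smooth_map_on_def o_def by blast
    then have "(\<lambda>x. F j (chart_inv \<kappa> x)) differentiable (at (snd \<kappa> p))"
      by (rule smooth_on_differentiable) (use \<kappa>(2) in blast)
    then have "frechet_derivative (\<lambda>x. F j (chart_inv \<kappa> x)) (at (snd \<kappa> p)) =
        frechet_derivative (\<lambda>x. \<Phi> (chart_inv \<kappa> x) (s (chart_inv \<kappa> x)) j) (at (snd \<kappa> p))"
      by (rule frechet_derivative_transform_within_open[OF _ nbhd_image])
         (use FN chart_image_iff[OF \<kappa>(1)] in blast)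
    then show "D (\<lambda>q. F j q *\<^sub>R e j q) p [coord_vec A \<kappa> p v] =
        twisted_deriv (e j p) (\<theta> j) (snd \<kappa> p) (\<lambda>x. \<Phi> (chart_inv \<kappa> x) (s (chart_inv \<kappa> x)) j) v"
      unfolding connection_leibniz[OF F[OF j] frame_sections[OF j]] ext_deriv_function_form twisted_deriv_def
      using FN[OF nbhd(2), of j] \<kappa> by simp
  qed
  finally show ?thesis .
qed

text \<open>The sign \<open>(-1)\<^sup>k\<close> in the Leibniz rule and the sign of the shuffle combine to \<open>(-1)\<^sup>i\<close>, so that
  the formula no longer refers to the degree. This is what lets it extend to inhomogeneous forms.\<close>

lemma tensor_in_frame:
  assumes \<tau>: "\<tau> \<in> scalar_forms A k" and s: "s \<in> smooth_sections A r V T"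
    and vs: "set vs \<subseteq> tangent_space A p"
  shows "tensor_section (ext_deriv A \<tau>) s p vs + (-1) ^ k *\<^sub>R wedge_one \<tau> (D s) p vs =
    (\<Sum>j<r. twisted_ext_deriv (e j p) (\<theta> j) (snd \<kappa> p)
      (\<lambda>x es. chart_form A \<kappa> \<tau> x es * \<Phi> (chart_inv \<kappa> x) (s (chart_inv \<kappa> x)) j) (coords vs))"
proof -
  let ?x = "snd \<kappa> p" and ?f = "\<lambda>j x. \<Phi> (chart_inv \<kappa> x) (s (chart_inv \<kappa> x)) j"
  let ?es = "coords vs" and ?t = "\<lambda>i x. chart_form A \<kappa> \<tau> x (drop_nth i (coords vs))"
  have p: "p \<in> U" using nbhd by blast
  have t: "?t i differentiable (at ?x)" for i
    by (rule smooth_on_differentiable[OF scalar_formD(3)[OF \<tau> \<kappa>(1)]]) (use \<kappa>(2) in blast)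
  have f: "?f j differentiable (at ?x)" if "j < r" for j
    by (rule smooth_on_differentiable[OF section_smooth[OF s triv that \<kappa>(1)]]) (use \<kappa>(2) p in blast)
  have sp: "(\<Sum>j<r. ?f j ?x *\<^sub>R e j p) = s p"
    using frame_expand[OF nbhd(2) section_fibre[OF s]] \<kappa> by simp
  have tx: "?t i ?x = \<tau> p (drop_nth i vs)" if "i < length vs" for i
    using chart_form_at[OF \<kappa>, of "drop_nth i vs" \<tau>] vs set_drop_nth_subset[of i vs]
    by (simp add: map_drop_nth)
  have summand: "(\<Sum>j<r. twisted_deriv (e j p) (\<theta> j) ?x (\<lambda>x. ?t i x * ?f j x) (?es ! i)) =
      frechet_derivative (?t i) (at ?x) ((vs ! i) \<kappa>) *\<^sub>R s p + \<tau> p (drop_nth i vs) *\<^sub>R D s p [vs ! i]"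
    if i: "i < length vs" for i
  proof -
    have vi: "coord_vec A \<kappa> p ((vs ! i) \<kappa>) = vs ! i"
      using coord_vec_of_tangent[OF \<kappa>] vs i by (meson nth_mem subsetD)
    have "(\<Sum>j<r. twisted_deriv (e j p) (\<theta> j) ?x (\<lambda>x. ?t i x * ?f j x) (?es ! i)) =
        (\<Sum>j<r. (frechet_derivative (?t i) (at ?x) ((vs ! i) \<kappa>) * ?f j ?x) *\<^sub>R e j p +
          ?t i ?x *\<^sub>R twisted_deriv (e j p) (\<theta> j) ?x (?f j) ((vs ! i) \<kappa>))"
      by (rule sum.cong[OF refl]) (use i in \<open>simp add: twisted_deriv_mult[OF t f]\<close>)
    also have "\<dots> = frechet_derivative (?t i) (at ?x) ((vs ! i) \<kappa>) *\<^sub>R (\<Sum>j<r. ?f j ?x *\<^sub>R e j p) +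
          ?t i ?x *\<^sub>R (\<Sum>j<r. twisted_deriv (e j p) (\<theta> j) ?x (?f j) ((vs ! i) \<kappa>))"
      by (simp only: sum.distrib scaleR_sum_right scaleR_scaleR)
    finally show ?thesis
      unfolding sp connection_in_frame[OF s, symmetric] vi tx[OF i] .
  qed
  have sign: "((-1) ^ k * ((-1) ^ (length vs - 1 - i) * \<tau> p (drop_nth i vs))) = (-1) ^ i * \<tau> p (drop_nth i vs)"
    if i: "i < length vs" for i
  proof (cases "length vs = Suc k")
    case True
    then have "k = i + (length vs - 1 - i)" using i by simp
    then obtain m where "k = i + m" "length vs - 1 - i = m" by blast
    then show ?thesis by (simp add: power_add flip: power_mult_distrib)
  next
    case False
    then have "length (drop_nth i vs) \<noteq> k" using i by (simp add: length_drop_nth)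
    then have "\<tau> p (drop_nth i vs) = 0" using scalar_formD(1)[OF \<tau>] unfolding homogeneous_def by blast
    then show ?thesis by simp
  qed
  have signed: "(-1) ^ k *\<^sub>R (((-1) ^ (length vs - 1 - i) * \<tau> p (drop_nth i vs)) *\<^sub>R D s p [vs ! i]) =
      (-1) ^ i *\<^sub>R (\<tau> p (drop_nth i vs) *\<^sub>R D s p [vs ! i])" if "i < length vs" for i
    unfolding scaleR_scaleR sign[OF that] ..
  have "tensor_section (ext_deriv A \<tau>) s p vs + (-1) ^ k *\<^sub>R wedge_one \<tau> (D s) p vs =
      (\<Sum>i<length vs. (-1) ^ i *\<^sub>R (frechet_derivative (?t i) (at ?x) ((vs ! i) \<kappa>) *\<^sub>R s p)) +
      (\<Sum>i<length vs. (-1) ^ i *\<^sub>R (\<tau> p (drop_nth i vs) *\<^sub>R D s p [vs ! i]))"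
    unfolding tensor_section_def wedge_one_def ext_deriv_in_chart[OF vs] scaleR_sum_left scaleR_sum_right
    by (intro arg_cong2[where f = "(+)"] sum.cong refl) (simp, simp only: lessThan_iff signed)
  also have "\<dots> = (\<Sum>i<length vs. \<Sum>j<r.
      (-1) ^ i *\<^sub>R twisted_deriv (e j p) (\<theta> j) ?x (\<lambda>x. ?t i x * ?f j x) (?es ! i))"
    unfolding sum.distrib[symmetric] scaleR_add_right[symmetric] scaleR_sum_right[symmetric]
    by (intro sum.cong refl) (simp only: summand lessThan_iff)
  also have "\<dots> = (\<Sum>j<r. twisted_ext_deriv (e j p) (\<theta> j) ?x (\<lambda>x es. chart_form A \<kappa> \<tau> x es * ?f j x) ?es)"
    unfolding twisted_ext_deriv_def length_map by (rule sum.swap)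
  finally show ?thesis .
qed

text \<open>If some argument is not tangent, then for each \<open>i\<close> it is either \<open>vs ! i\<close>, where \<open>D s\<close> vanishes, or among the
  arguments of \<open>\<tau>\<close>.\<close>

lemma tensor_off_tangent:
  assumes \<tau>: "\<tau> \<in> scalar_forms A k" and s: "s \<in> smooth_sections A r V T"
    and vs: "\<not> set vs \<subseteq> tangent_space A p"
  shows "tensor_section (ext_deriv A \<tau>) s p vs + c *\<^sub>R wedge_one \<tau> (D s) p vs = 0"
proof -
  have "\<tau> p (drop_nth i vs) *\<^sub>R D s p [vs ! i] = 0" if "i < length vs" for i
  proof (cases "vs ! i \<in> tangent_space A p")
    case True
    then have "\<not> set (drop_nth i vs) \<subseteq> tangent_space A p"
      using vs set_drop_nth[OF that] by (metis insert_subset)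
    then show ?thesis using alternating_onD(2)[OF scalar_formD(2)[OF \<tau>]] by simp
  next
    case False
    then have "D s p [vs ! i] = 0"
      by (intro alternating_onD(2)[OF bundle_formD(1)[OF connection_forms(1)[OF s]]]) simp
    then show ?thesis by simp
  qed
  then have "wedge_one \<tau> (D s) p vs = 0"
    unfolding wedge_one_def by (intro sum.neutral) (auto simp flip: scaleR_scaleR)
  then show ?thesis using vs by (simp add: tensor_section_def ext_deriv_def)
qed

text \<open>Near \<open>p\<close>, \<open>\<omega>\<close> is the sum over \<open>j\<close> of its cut-off components times \<open>e j\<close>, separated by degree. Degrees
  above the number of frame vectors of the model space do not contribute, which makes the sum finite.\<close>

lemma form_decomposition:
  assumes \<omega>: "\<omega> \<in> bundle_forms A r V T"
  obtains n :: nat and k \<tau> s where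
    "\<And>i. i < n \<Longrightarrow> \<tau> i \<in> scalar_forms A (k i) \<and> s i \<in> smooth_sections A r V T"
    "\<And>q vs. q \<in> N \<Longrightarrow> \<omega> q vs = (\<Sum>i<n. tensor_section (\<tau> i) (s i) q vs)"
proof -
  obtain B where B: "parseval_frame (B::'e set)" by (rule frame_exists)
  let ?I = "{..card B} \<times> {..<r}"
  obtain h where h: "bij_betw h {..<card ?I} ?I"
    using ex_bij_betw_nat_finite[of ?I] unfolding atLeast0LessThan by blast
  note alt = alternating_onD[OF bundle_formD(1)[OF \<omega>]]
  define \<tau> where "\<tau> = (\<lambda>(k, j) q vs. if length vs = k then \<beta> q * \<Phi> q (\<omega> q vs) j else 0)"
  have \<tau>: "\<tau> (k, j) \<in> scalar_forms A k" if j: "j < r" for k j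
  proof -
    have "homogeneous k (\<tau> (k, j))" by (simp add: homogeneous_def \<tau>_def)
    moreover have "alternating_on (tangent_space A q) UNIV (\<tau> (k, j) q)" for q
    proof (cases "q \<in> U")
      case True
      show ?thesis
        unfolding alternating_on_def
      proof (intro conjI allI impI)
        show "\<tau> (k, j) q vs = 0" if "\<not> set vs \<subseteq> tangent_space A q" for vs
          using alt(2)[OF that] trivialization_zero[OF triv True] by (simp add: \<tau>_def)
        show "\<tau> (k, j) q vs = 0"
          if "set vs \<subseteq> tangent_space A q \<and> i < l \<and> l < length vs \<and> vs ! i = vs ! l" for vs i l
          using alt(4)[of vs q i l] that trivialization_zero[OF triv True] by (simp add: \<tau>_def)
        show "\<tau> (k, j) q (us @ (\<lambda>\<kappa>. a *\<^sub>R v \<kappa> + b *\<^sub>R w \<kappa>) # vs) =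
            a *\<^sub>R \<tau> (k, j) q (us @ v # vs) + b *\<^sub>R \<tau> (k, j) q (us @ w # vs)"
          if "set us \<subseteq> tangent_space A q \<and> v \<in> tangent_space A q \<and> w \<in> tangent_space A q \<and>
            set vs \<subseteq> tangent_space A q" for us v w vs a b
          using alt(3)[of us q v w vs a b] that trivialization(3)[OF triv True alt(1) alt(1)]
          by (simp add: \<tau>_def algebra_simps)
      qed simp
    next
      case False
      then have "\<beta> q = 0" using bump_support by blast
      then have "\<tau> (k, j) q = (\<lambda>vs. 0)" by (auto simp: \<tau>_def)
      then show ?thesis unfolding alternating_on_def by simp
    qed
    moreover have "smooth_on (snd \<mu> ` fst \<mu>) (\<lambda>x. \<tau> (k, j) (chart_inv \<mu> x) (map (coord_vec A \<mu> (chart_inv \<mu> x)) es))"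
      if \<mu>: "\<mu> \<in> A" for \<mu> es
    proof (cases "length es = k")
      case True
      have "smooth_on (snd \<mu> ` (fst \<mu> \<inter> (UNIV \<inter> U))) (\<lambda>x. component A \<mu> \<Phi> j \<omega> x es)"
        using bundle_formD(2)[OF \<omega> \<mu> triv j] by simp
      from smooth_bump_mult[OF \<mu> bump_smooth _ bump_support(1,2) open_UNIV trivialization(1)[OF triv] this]
      have "smooth_on (snd \<mu> ` (fst \<mu> \<inter> UNIV)) (\<lambda>x. \<beta> (chart_inv \<mu> x) * component A \<mu> \<Phi> j \<omega> x es)"
        using bump_support(3) by blast
      then show ?thesis using True by (simp add: \<tau>_def component_def chart_form_def)
    next
      case False
      then show ?thesis
        using smooth_on_const[OF open_chart_image[OF \<mu> open_UNIV], of 0] by (simp add: \<tau>_def)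
    qed
    ultimately show ?thesis unfolding scalar_forms_def by blast
  qed
  have sum: "\<omega> q vs = (\<Sum>i<card ?I. tensor_section (\<tau> (h i)) (e (snd (h i))) q vs)" if q: "q \<in> N" for q vs
  proof -
    have "(\<Sum>i<card ?I. tensor_section (\<tau> (h i)) (e (snd (h i))) q vs) =
        (\<Sum>kj\<in>?I. tensor_section (\<tau> kj) (e (snd kj)) q vs)"
      by (rule sum.reindex_bij_betw[OF h])
    also have "\<dots> = (\<Sum>k\<le>card B. \<Sum>j<r. tensor_section (\<tau> (k, j)) (e j) q vs)"
      unfolding sum.cartesian_product case_prod_beta by simp
    also have "\<dots> = (\<Sum>k\<le>card B. if k = length vs then \<Sum>j<r. \<Phi> q (\<omega> q vs) j *\<^sub>R e j q else 0)"
      by (rule sum.cong[OF refl]) (auto simp: tensor_section_def \<tau>_def bump_one[OF q])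
    also have "\<dots> = (if length vs \<le> card B then \<omega> q vs else 0)"
      by (simp add: frame_expand[OF q alt(1)])
    also have "\<dots> = \<omega> q vs"
    proof (cases "length vs \<le> card B")
      case False
      have "\<omega> q vs = 0"
      proof (cases "set vs \<subseteq> tangent_space A q")
        case True
        obtain \<mu> where \<mu>: "\<mu> \<in> A" "q \<in> fst \<mu>" by (rule chart_around)
        have "\<omega> q (map (coord_vec A \<mu> q) (map (\<lambda>v. v \<mu>) vs)) = 0"
          using alternating_map_vanishes[OF B alternating_map_of_alternating_on[OF bundle_formD(1)[OF \<omega>] \<mu>],
              of "[]" "map (\<lambda>v. v \<mu>) vs"] False by simp
        then show ?thesis unfolding map_coord_vec_of_tangent[OF \<mu> True] .
      qed (rule alt(2))
      then show ?thesis by simp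
    qed simp
    finally show ?thesis by simp
  qed
  have mem: "h i \<in> ?I" if "i < card ?I" for i
    using bij_betw_apply[OF h, of i] that by simp
  show ?thesis
  proof (rule that[of "card ?I" "\<lambda>i. \<tau> (h i)" "\<lambda>i. fst (h i)" "\<lambda>i. e (snd (h i))"])
    fix i assume "i < card ?I"
    from mem[OF this] have "snd (h i) < r" by auto
    then show "\<tau> (h i) \<in> scalar_forms A (fst (h i)) \<and> e (snd (h i)) \<in> smooth_sections A r V T"
      using \<tau>[of "snd (h i)" "fst (h i)"] frame_sections by simp
  qed (rule sum)
qed

text \<open>Every admissible decomposition of \<open>\<omega>\<close> gives the same value, because the right-hand side depends on \<open>\<omega>\<close>
  only: \<open>tensor_in_frame\<close> puts each summand into this form, and the form is additive in the components. This is
  the well-definedness of \<open>\<nabla>\<close>, and at the same time the formula by which it is computed.\<close>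

lemma cov_deriv_in_frame:
  assumes \<omega>: "\<omega> \<in> bundle_forms A r V T"
  shows "cov_deriv A r V T D \<omega> p vs = (if set vs \<subseteq> tangent_space A p
    then \<Sum>j<r. twisted_ext_deriv (e j p) (\<theta> j) (snd \<kappa> p) (component A \<kappa> \<Phi> j \<omega>) (coords vs) else 0)"
proof -
  let ?F = "\<lambda>vs. if set vs \<subseteq> tangent_space A p
    then \<Sum>j<r. twisted_ext_deriv (e j p) (\<theta> j) (snd \<kappa> p) (component A \<kappa> \<Phi> j \<omega>) (coords vs) else 0"
  let ?G = "\<lambda>(n::nat) k \<tau> s vs. \<Sum>i<n. tensor_section (ext_deriv A (\<tau> i)) (s i) p vs
      + (-1) ^ k i *\<^sub>R wedge_one (\<tau> i) (D (s i)) p vs"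
  let ?P = "\<lambda>O' (n::nat) k \<tau> s. open O' \<and> p \<in> O' \<and>
     (\<forall>i<n. \<tau> i \<in> scalar_forms A (k i) \<and> s i \<in> smooth_sections A r V T) \<and>
     (\<forall>q\<in>O'. \<forall>vs. \<omega> q vs = (\<Sum>i<n. tensor_section (\<tau> i) (s i) q vs))"
  have unique: "?G n k \<tau> s = ?F" if P: "?P O' n k \<tau> s" for O' n k \<tau> s
  proof
    fix vs
    have \<tau>: "\<tau> i \<in> scalar_forms A (k i)" and s: "s i \<in> smooth_sections A r V T" if "i < n" for i
      using P that by blast+
    show "?G n k \<tau> s vs = ?F vs"
    proof (cases "set vs \<subseteq> tangent_space A p")
      case True
      let ?S = "snd \<kappa> ` (fst \<kappa> \<inter> (O' \<inter> N))"
      let ?W = "\<lambda>j i x es. chart_form A \<kappa> (\<tau> i) x es * \<Phi> (chart_inv \<kappa> x) (s i (chart_inv \<kappa> x)) j"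
      have S: "open ?S" "snd \<kappa> p \<in> ?S"
        using open_chart_image[OF \<kappa>(1)] P nbhd \<kappa>(2) by blast+
      have W: "component A \<kappa> \<Phi> j \<omega> x es = (\<Sum>i<n. ?W j i x es)" if "x \<in> ?S" for j x es
      proof -
        have q: "chart_inv \<kappa> x \<in> O'" "chart_inv \<kappa> x \<in> U"
          using that chart_image_iff[OF \<kappa>(1)] nbhd(3) by blast+
        have "chart_form A \<kappa> \<omega> x es = (\<Sum>i<n. chart_form A \<kappa> (\<tau> i) x es *\<^sub>R s i (chart_inv \<kappa> x))"
          using P q(1) unfolding chart_form_def tensor_section_def by blast
        moreover have "\<Phi> (chart_inv \<kappa> x) (\<Sum>i<n. chart_form A \<kappa> (\<tau> i) x es *\<^sub>R s i (chart_inv \<kappa> x)) j =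
            (\<Sum>i<n. ?W j i x es)"
          by (rule trivialization_sum[OF triv q(2) finite_lessThan]) (rule section_fibre[OF s], simp)
        ultimately show ?thesis unfolding component_def by simp
      qed
      have dW: "(\<lambda>x. ?W j i x es) differentiable (at (snd \<kappa> p))" if "i < n" "j < r" for i j es
      proof (rule differentiable_mult)
        show "(\<lambda>x. chart_form A \<kappa> (\<tau> i) x es) differentiable (at (snd \<kappa> p))"
          by (rule smooth_on_differentiable[OF scalar_formD(3)[OF \<tau>[OF that(1)] \<kappa>(1)]]) (use \<kappa>(2) in blast)
        show "(\<lambda>x. \<Phi> (chart_inv \<kappa> x) (s i (chart_inv \<kappa> x)) j) differentiable (at (snd \<kappa> p))"
          by (rule smooth_on_differentiable[OF section_smooth[OF s[OF that(1)] triv that(2) \<kappa>(1)]])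
             (use \<kappa>(2) nbhd in blast)
      qed
      have "?G n k \<tau> s vs =
          (\<Sum>i<n. \<Sum>j<r. twisted_ext_deriv (e j p) (\<theta> j) (snd \<kappa> p) (?W j i) (coords vs))"
        by (intro sum.cong refl tensor_in_frame[OF _ _ True]) (use \<tau> s in auto)
      also have "\<dots> = (\<Sum>j<r. \<Sum>i<n. twisted_ext_deriv (e j p) (\<theta> j) (snd \<kappa> p) (?W j i) (coords vs))"
        by (rule sum.swap)
      also have "\<dots> = (\<Sum>j<r. twisted_ext_deriv (e j p) (\<theta> j) (snd \<kappa> p) (component A \<kappa> \<Phi> j \<omega>) (coords vs))"
        by (intro sum.cong refl twisted_ext_deriv_sum[OF S, symmetric] W dW) simp_all
      finally show ?thesis using True by simp
    next
      case False
      then show ?thesis using tensor_off_tangent[OF \<tau> s False] by simp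
    qed
  qed
  obtain n :: nat and k \<tau> s where
    dec: "\<And>i. i < n \<Longrightarrow> \<tau> i \<in> scalar_forms A (k i) \<and> s i \<in> smooth_sections A r V T"
      "\<And>q vs. q \<in> N \<Longrightarrow> \<omega> q vs = (\<Sum>i<n. tensor_section (\<tau> i) (s i) q vs)"
    by (rule form_decomposition[OF \<omega>]) blast
  have P: "?P N n k \<tau> s" using dec nbhd(1,2) by blast
  have "cov_deriv A r V T D \<omega> p = ?F"
    unfolding cov_deriv_def
  proof (rule the_equality)
    show "\<exists>O' n k \<tau> s. open O' \<and> p \<in> O' \<and>
        (\<forall>i<n. \<tau> i \<in> scalar_forms A (k i) \<and> s i \<in> smooth_sections A r V T) \<and>
        (\<forall>q\<in>O'. \<forall>vs. \<omega> q vs = (\<Sum>i<n. tensor_section (\<tau> i) (s i) q vs)) \<and> ?F = ?G n k \<tau> s"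
      using P unique[OF P, symmetric] by blast
  next
    fix y assume "\<exists>O' n k \<tau> s. open O' \<and> p \<in> O' \<and>
        (\<forall>i<n. \<tau> i \<in> scalar_forms A (k i) \<and> s i \<in> smooth_sections A r V T) \<and>
        (\<forall>q\<in>O'. \<forall>vs. \<omega> q vs = (\<Sum>i<n. tensor_section (\<tau> i) (s i) q vs)) \<and> y = ?G n k \<tau> s"
    then obtain O' n k \<tau> s where "?P O' n k \<tau> s" "y = ?G n k \<tau> s" by blast
    then show "y = ?F" using unique by blast
  qed
  then show ?thesis by simp
qed

end


section \<open>Cartan's formula\<close>

context framed_point
begin

text \<open>Each of the four covariant derivatives is a sum over the frame of a local expression in the components of \<open>\<omega>\<close>,
  \<open>X\<close> and \<open>Y\<close>, and the local formula applies to every frame index separately.\<close>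

lemma cartan_formula_at:
  assumes X: "smooth_vector_field A X" and Y: "smooth_vector_field A Y"
    and \<omega>: "\<omega> \<in> bundle_forms A r V T"
  defines "nabla \<equiv> cov_deriv A r V T D"
  shows "\<omega> p (lie_bracket A X Y p # vs) =
      nabla (contract Y \<omega>) p (X p # vs) + nabla (contract X (contract Y \<omega>)) p vs
    - nabla \<omega> p (X p # Y p # vs) - nabla (contract X \<omega>) p (Y p # vs)"
proof -
  note Y\<omega> = contract_bundle_form[OF Y \<omega>] and X\<omega> = contract_bundle_form[OF X \<omega>]
  note XY\<omega> = contract_bundle_form[OF X Y\<omega>]
  note frame = cov_deriv_in_frame[OF Y\<omega>] cov_deriv_in_frame[OF XY\<omega>] cov_deriv_in_frame[OF \<omega>]
    cov_deriv_in_frame[OF X\<omega>]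
  note L = lie_bracket_tangent[OF X Y, of p]
  have tan: "X p \<in> tangent_space A p" "Y p \<in> tangent_space A p"
    using X Y unfolding smooth_vector_field_def by blast+
  show ?thesis
  proof (cases "set vs \<subseteq> tangent_space A p")
    case False
    then have off: "\<not> set (l @ vs) \<subseteq> tangent_space A p" for l by simp
    have "\<omega> p (lie_bracket A X Y p # vs) = 0"
      by (rule alternating_onD(2)[OF bundle_formD(1)[OF \<omega>]]) (use off[of "[_]"] in simp)
    then show ?thesis
      unfolding nabla_def frame using off[of "[X p]"] off[of "[]"] off[of "[X p, Y p]"] off[of "[Y p]"]
      by simp
  next
    case True
    obtain B where B: "parseval_frame (B::'e set)" by (rule frame_exists)
    let ?x = "snd \<kappa> p" and ?S = "snd \<kappa> ` (fst \<kappa> \<inter> N)" and ?es = "coords vs"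
    let ?X = "\<lambda>x. X (chart_inv \<kappa> x) \<kappa>" and ?Y = "\<lambda>x. Y (chart_inv \<kappa> x) \<kappa>"
    let ?TD = "\<lambda>j. twisted_ext_deriv (e j p) (\<theta> j) ?x" and ?W = "\<lambda>j. component A \<kappa> \<Phi> j \<omega>"
    have XYp: "?X ?x = X p \<kappa>" "?Y ?x = Y p \<kappa>" using \<kappa> by simp_all
    have SU: "?S \<subseteq> snd \<kappa> ` (fst \<kappa> \<inter> U)" "?S \<subseteq> snd \<kappa> ` fst \<kappa>" using nbhd(3) by blast+
    have diff: "(\<lambda>x. component A \<kappa> \<Phi> j \<eta> x es) differentiable (at ?x)"
      if "\<eta> \<in> bundle_forms A r V T" "j < r" for \<eta> j es
      by (rule smooth_on_differentiable[OF bundle_formD(2)[OF that(1) \<kappa>(1) triv that(2)]])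
         (use nbhd_image(2) SU(1) in blast)
    have dX: "?X differentiable (at ?x)" and dY: "?Y differentiable (at ?x)"
      using smooth_on_differentiable[OF vector_field_smooth[OF X \<kappa>(1)]]
        smooth_on_differentiable[OF vector_field_smooth[OF Y \<kappa>(1)]] \<kappa>(2) by blast+
    have comp: "component A \<kappa> \<Phi> j (contract Z \<eta>) x es = component A \<kappa> \<Phi> j \<eta> x (Z (chart_inv \<kappa> x) \<kappa> # es)"
      if "smooth_vector_field A Z" "x \<in> ?S" for Z \<eta> j x es
      by (rule component_contract[OF that(1) \<kappa>(1)]) (use that(2) SU(2) in blast)
    have Yw: "?TD j (component A \<kappa> \<Phi> j (contract Y \<omega>)) es = ?TD j (\<lambda>x es. ?W j x (?Y x # es)) es"
      if "j < r" for j es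
      by (rule twisted_ext_deriv_cong[OF nbhd_image, symmetric])
         (rule comp[OF Y, symmetric], assumption, rule diff[OF Y\<omega> that])
    have Xw: "?TD j (component A \<kappa> \<Phi> j (contract X \<omega>)) es = ?TD j (\<lambda>x es. ?W j x (?X x # es)) es"
      if "j < r" for j es
      by (rule twisted_ext_deriv_cong[OF nbhd_image, symmetric])
         (rule comp[OF X, symmetric], assumption, rule diff[OF X\<omega> that])
    have XYw: "?TD j (component A \<kappa> \<Phi> j (contract X (contract Y \<omega>))) es =
        ?TD j (\<lambda>x es. ?W j x (?Y x # ?X x # es)) es" if "j < r" for j es
      by (rule twisted_ext_deriv_cong[OF nbhd_image, symmetric])
         (simp only: comp[OF X] comp[OF Y], rule diff[OF XY\<omega> that])
    have "\<omega> p (lie_bracket A X Y p # vs) = (\<Sum>j<r. \<Phi> p (\<omega> p (lie_bracket A X Y p # vs)) j *\<^sub>R e j p)"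
      by (rule frame_expand[OF nbhd(2) alternating_onD(1)[OF bundle_formD(1)[OF \<omega>]], symmetric])
    also have "\<dots> = (\<Sum>j<r. ?W j ?x ((frechet_derivative ?Y (at ?x) (?X ?x)
        - frechet_derivative ?X (at ?x) (?Y ?x)) # ?es) *\<^sub>R e j p)"
    proof (rule sum.cong[OF refl])
      fix j
      have "\<Phi> p (\<omega> p (lie_bracket A X Y p # vs)) j = ?W j ?x (coords (lie_bracket A X Y p # vs))"
        using chart_form_at[OF \<kappa>, of "lie_bracket A X Y p # vs" \<omega>] True L \<kappa>
        by (simp add: component_def)
      moreover have "lie_bracket A X Y p \<kappa> = frechet_derivative ?Y (at ?x) (?X ?x)
        - frechet_derivative ?X (at ?x) (?Y ?x)"
        unfolding XYp using \<kappa> by (simp add: lie_bracket_def)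
      ultimately show "\<Phi> p (\<omega> p (lie_bracket A X Y p # vs)) j *\<^sub>R e j p =
          ?W j ?x ((frechet_derivative ?Y (at ?x) (?X ?x)
            - frechet_derivative ?X (at ?x) (?Y ?x)) # ?es) *\<^sub>R e j p"
        by (simp only: list.map)
    qed
    also have "\<dots> = (\<Sum>j<r. ?TD j (\<lambda>x es. ?W j x (?Y x # es)) (?X ?x # ?es)
        + ?TD j (\<lambda>x es. ?W j x (?Y x # ?X x # es)) ?es
        - ?TD j (?W j) (?X ?x # ?Y ?x # ?es)
        - ?TD j (\<lambda>x es. ?W j x (?X x # es)) (?Y ?x # ?es))"
    proof (rule sum.cong[OF refl])
      fix j assume "j \<in> {..<r}"
      then have j: "j < r" by simp
      show "?W j ?x ((frechet_derivative ?Y (at ?x) (?X ?x)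
            - frechet_derivative ?X (at ?x) (?Y ?x)) # ?es) *\<^sub>R e j p =
          ?TD j (\<lambda>x es. ?W j x (?Y x # es)) (?X ?x # ?es)
          + ?TD j (\<lambda>x es. ?W j x (?Y x # ?X x # es)) ?es
          - ?TD j (?W j) (?X ?x # ?Y ?x # ?es)
          - ?TD j (\<lambda>x es. ?W j x (?X x # es)) (?Y ?x # ?es)"
        by (rule cartan_formula_local[OF B nbhd_image _ diff[OF \<omega> j] dX dY])
           (rule component_alternating[OF \<omega> \<kappa>(1) triv], use SU(1) in blast)
    qed
    also have "\<dots> = (\<Sum>j<r. ?TD j (component A \<kappa> \<Phi> j (contract Y \<omega>)) (coords (X p # vs)))
        + (\<Sum>j<r. ?TD j (component A \<kappa> \<Phi> j (contract X (contract Y \<omega>))) ?es)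
        - (\<Sum>j<r. ?TD j (?W j) (coords (X p # Y p # vs)))
        - (\<Sum>j<r. ?TD j (component A \<kappa> \<Phi> j (contract X \<omega>)) (coords (Y p # vs)))"
      unfolding XYp sum_subtractf[symmetric] sum.distrib[symmetric] list.map
      by (rule sum.cong[OF refl]) (simp only: Yw Xw XYw lessThan_iff)
    moreover have "set (X p # vs) \<subseteq> tangent_space A p" "set (X p # Y p # vs) \<subseteq> tangent_space A p"
      "set (Y p # vs) \<subseteq> tangent_space A p"
      using True tan by simp_all
    ultimately show ?thesis
      unfolding nabla_def frame using True by (simp only: if_True)
  qed
qed

end

theorem lemma2p1:
  fixes A :: "('m::{t2_space,second_countable_topology}, 'e::real_inner) chart set"
    and g :: "'m \<Rightarrow> ('m, 'e) tangent \<Rightarrow> ('m, 'e) tangent \<Rightarrow> real"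
    and r :: nat
    and V :: "'m \<Rightarrow> 'w::real_vector set"
    and T :: "('m, 'w) triv set"
    and D :: "('m \<Rightarrow> 'w) \<Rightarrow> ('m, 'e, 'w) form"
    and X Y :: "'m \<Rightarrow> ('m, 'e) tangent"
    and \<omega> :: "('m, 'e, 'w) form"
  defines "nabla \<equiv> cov_deriv A r V T D"
  assumes "smooth_atlas A"
    and "riemannian_metric A g"
    and "vector_bundle A r V T"
    and "connection A r V T D"
    and "smooth_vector_field A X"
    and "smooth_vector_field A Y"
    and "\<omega> \<in> bundle_forms A r V T"
  shows "contract (lie_bracket A X Y) \<omega> =
    (\<lambda>p vs. contract X (nabla (contract Y \<omega>)) p vs
          + nabla (contract X (contract Y \<omega>)) p vs
          - contract Y (contract X (nabla \<omega>)) p vs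
          - contract Y (nabla (contract X \<omega>)) p vs)"
proof (intro ext)
  fix p vs
  interpret bundle_connection A r V T D
    by unfold_locales (use assms in auto)
  obtain U \<Phi> where U: "(U, \<Phi>) \<in> T" "p \<in> U" by (rule trivialization_around)
  obtain \<beta> :: "'m \<Rightarrow> real" and K N e where "smooth_map_on A UNIV \<beta>" "closed K" "K \<subseteq> U"
    "\<And>q. q \<notin> K \<Longrightarrow> \<beta> q = 0" "open N" "p \<in> N" "N \<subseteq> U" "\<And>q. q \<in> N \<Longrightarrow> \<beta> q = 1"
    "\<And>j. j < r \<Longrightarrow> e j \<in> smooth_sections A r V T"
    "\<And>q v. q \<in> N \<Longrightarrow> v \<in> V q \<Longrightarrow> (\<Sum>j<r. \<Phi> q v j *\<^sub>R e j q) = v"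
    by (rule local_frame[OF U]) blast
  with U(1) interpret framed_point A r V T D U \<Phi> p \<beta> K N e
    by unfold_locales
  show "contract (lie_bracket A X Y) \<omega> p vs =
      contract X (nabla (contract Y \<omega>)) p vs
    + nabla (contract X (contract Y \<omega>)) p vs
    - contract Y (contract X (nabla \<omega>)) p vs
    - contract Y (nabla (contract X \<omega>)) p vs"
    using cartan_formula_at[OF assms(6,7,8), of vs]
    unfolding nabla_def contract_def .
qed

end
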